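(* Every $\mathsf{QCD}$ space satisfies the Sobolev-to-Lipschitz property. That is: let $(X,d,m)$ be a geodesic Monge space satisfying $\mathsf{QCD}(Q,K,N)$ for some $Q\ge1$, $K\in\mathbb R$, $N\in(1,\infty)$. Then every $f\in W^{1,2}(X,d,m)\cap L^\infty(m)$ with $|\mathrm Df|_w\le1$ $m$-a.e. coincides $m$-a.e. with a Lipschitz function $\hat f:X\to\mathbb R$ with global Lipschitz constant at most $1$.
   Context: A metric measure space $(X,d,m)$ is a complete separable metric space $(X,d)$ with an atomless Borel measure $m$ which is finite on bounded sets and has full topological support. It is geodesic if any two points are joined by a constant-speed geodesic. $\mathscr P_2(X)$ is the set of Borel probability measures with finite second moment, with the $L^2$-Wasserstein distance $W_2$; $\mathscr P^m_c(X)$ is the set of compactly supported Borel probability measures absolutely continuous w.r.t. $m$. Let $I=[0,1]$, let $\mathrm{Geo}(X,d)$ be the set of constant-speed geodesics $\gamma:I\to X$, i.e. $d(\gamma_s,\gamma_t)=|s-t|\,d(\gamma_0,\gamma_1)$, and let $\mathrm{ev}_t(\gamma)=\gamma_t$. $\mathrm{OptGeo}(\mu_0,\mu_1)$ is the set of Borel probability measures $\pi$ on $\mathcal C(I;X)$ concentrated on $\mathrm{Geo}(X,d)$ with $(\mathrm{ev}_i)_\sharp\pi=\mu_i$, $i=0,1$, and $W_2(\mu_0,\mu_1)^2=\int\int_I|\dot\gamma|_t^2\,dt\,d\pi(\gamma)$. Monge space: for every $\mu_0,\mu_1\in\mathscr P_2(X)$ with $\mu_0\ll m$: (a) there is a unique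 $\pi\in\mathrm{OptGeo}(\mu_0,\mu_1)$; (b) $\pi=T_\sharp\mu_0$ for some map $T:X\to\mathrm{Geo}(X,d)$; (c) $\mu_t:=(\mathrm{ev}_t)_\sharp\pi\ll m$ for all $t\in[0,1)$. Write $\rho_t=d\mu_t/dm$. Distortion coefficients: for $K\in\mathbb R$, $N\in(1,\infty)$, $t\in(0,1)$, $\theta\ge0$, put $\tau^{(t)}_{K,N}(\theta)=t^{1/N}\big(\sigma^{(t)}_{K,N-1}(\theta)\big)^{1-1/N}$, where, with $\kappa=K/(N-1)$, $\sigma^{(t)}_{K,N-1}(\theta)=\sin(t\theta\sqrt{\kappa})/\sin(\theta\sqrt{\kappa})$ if $K>0$ and $0<\theta<\pi/\sqrt\kappa$, $=+\infty$ if $K>0$ and $\theta\ge\pi/\sqrt\kappa$, $=t$ if $K=0$ or $\theta=0$, and $=\sinh(t\theta\sqrt{-\kappa})/\sinh(\theta\sqrt{-\kappa})$ if $K<0$ and $\theta>0$. A geodesic Monge space satisfies $\mathsf{QCD}(Q,K,N)$ if for every $\mu_0,\mu_1\in\mathscr P^m_c(X)$, with $\pi$ the unique element of $\mathrm{OptGeo}(\mu_0,\mu_1)$, $$\rho_t^{-1/N}(\gamma_t)\ge Q^{-1/N}\Big(\tau^{(1-t)}_{K,N}(d(\gamma_0,\gamma_1))\,\rho_0^{-1/N}(\gamma_0)+\tau^{(t)}_{K,N}(d(\gamma_0,\gamma_1))\,\rho_1^{-1/N}(\gamma_1)\Big)$$ for every $t\in(0,1)$ and $\pi$-a.e. $\gamma$.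 Cheeger energy: for Lipschitz $f$ the slope is $|\mathrm Df|(x)=\limsup_{y\to x}|f(y)-f(x)|/d(x,y)$ ($0$ if $x$ is isolated). $\mathrm{Lip}_{bs}(d)$ is the space of Lipschitz functions with bounded support. $\mathsf{Ch}(f)=\inf\{\liminf_n\int_X|\mathrm Df_n|^2\,dm: f_n\in\mathrm{Lip}_{bs}(d),\ f_n\to f\text{ in }L^2(m)\}$ ($\inf\varnothing=+\infty$), and $W^{1,2}=W^{1,2}(X,d,m)=\{f\in L^2(m):\mathsf{Ch}(f)<\infty\}$. For $f\in W^{1,2}$, $|\mathrm Df|_w\in L^2(m)$ is the weak minimal upper gradient: the element of minimal $L^2(m)$-norm among all weak $L^2(m)$-limits of $|\mathrm Df_n|$ with $f_n\in\mathrm{Lip}_{bs}(d)$, $f_n\to f$ in $L^2(m)$; one has $\mathsf{Ch}(f)=\int|\mathrm Df|_w^2\,dm$. *)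

theory Defs
  imports "HOL-Probability.Probability"
begin

section \<open>Metric measure spaces\<close>

definition measure_support :: "'a::topological_space measure \<Rightarrow> 'a set" where
  "measure_support \<mu> = {x. \<forall>U. open U \<and> x \<in> U \<longrightarrow> emeasure \<mu> U > 0}"

definition atomless :: "'a measure \<Rightarrow> bool" where
  "atomless \<mu> \<longleftrightarrow> (\<forall>A\<in>sets \<mu>. emeasure \<mu> A > 0 \<longrightarrow>
     (\<exists>B\<in>sets \<mu>. B \<subseteq> A \<and> 0 < emeasure \<mu> B \<and> emeasure \<mu> B < emeasure \<mu> A))"

text \<open>
  The metric space \<open>X\<close> is the whole type \<open>'a\<close>; the class \<open>polish_space\<close> says that its
  given metric is complete and its topology second countable.
\<close>

locale metric_measure_space =
  fixes m :: "'a::polish_space measure"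
  assumes sets_eq_borel: "sets m = sets borel"
    and atomless: "atomless m"
    and finite_on_bounded: "\<And>B. B \<in> sets borel \<Longrightarrow> bounded B \<Longrightarrow> emeasure m B < \<infinity>"
    and full_support: "measure_support m = UNIV"

section \<open>Curves and geodesics\<close>

text \<open>
  \<open>\<C>(I;X)\<close> with the supremum metric. Its elements are functions on the reals that are
  continuous on \<open>{0..1}\<close> and have the value \<open>undefined\<close> elsewhere.
\<close>

definition curve_metric :: "(real \<Rightarrow> 'a::metric_space) metric" where
  "curve_metric = cfunspace (top_of_set {0..1}) euclidean_metric"

abbreviation curves :: "(real \<Rightarrow> 'a::metric_space) set" where
  "curves \<equiv> mspace curve_metric"

definition borel_curves :: "(real \<Rightarrow> 'a::metric_space) measure" where
  "borel_curves = sigma curves {U. openin (mtopology_of curve_metric) U}"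

lemma mem_curves_iff:
  fixes \<gamma> :: "real \<Rightarrow> 'a::metric_space"
  shows "\<gamma> \<in> curves \<longleftrightarrow> \<gamma> \<in> extensional {0..1} \<and> continuous_on {0..1} \<gamma>"
proof -
  have eq: "Metric_space.mbounded UNIV (dist :: 'a \<Rightarrow> 'a \<Rightarrow> real) S \<longleftrightarrow> bounded S" for S
    by (metis Met_TC.mbounded_def bounded_subset_cball bounded_subset bounded_cball mcball_eq_cball)
  have "bounded (\<gamma> ` {0..1})" if "continuous_on {0..1} \<gamma>"
    using that by (intro compact_imp_bounded compact_continuous_image) auto
  then show ?thesis
    by (auto simp: curve_metric_def eq)
qed

lemma measurable_evaluation:
  assumes "t \<in> {0..1}"
  shows "(\<lambda>\<gamma>. \<gamma> t) \<in> borel_curves \<rightarrow>\<^sub>M (borel :: 'a::metric_space measure)"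
proof (rule borel_measurableI)
  fix S :: "'a set" assume "open S"
  have pow: "{U. openin (mtopology_of curve_metric) U} \<subseteq> Pow (curves :: (real \<Rightarrow> 'a) set)"
    using openin_subset by fastforce
  then have sp: "space borel_curves = (curves :: (real \<Rightarrow> 'a) set)"
    by (simp add: borel_curves_def space_measure_of)
  have lip: "dist (f t) (g t) \<le> mdist curve_metric f g"
    if "f \<in> curves" "g \<in> curves" for f g :: "real \<Rightarrow> 'a"
    using cfunspace_mdist_le[of f "top_of_set {0..1}" euclidean_metric g
        "mdist curve_metric f g"] that assms
    by (auto simp: curve_metric_def)
  have "openin (mtopology_of curve_metric) ((\<lambda>\<gamma>. \<gamma> t) -` S \<inter> (curves :: (real \<Rightarrow> 'a) set))"
    unfolding mtopology_of_def Metric_space.openin_mtopology[OF Metric_space_mspace_mdist]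
  proof (intro conjI allI impI)
    fix f :: "real \<Rightarrow> 'a" assume f: "f \<in> (\<lambda>\<gamma>. \<gamma> t) -` S \<inter> curves"
    then obtain r where r: "r > 0" "ball (f t) r \<subseteq> S"
      using \<open>open S\<close> open_contains_ball by (metis IntE vimageE)
    have "Metric_space.mball curves (mdist curve_metric) f r
            \<subseteq> (\<lambda>\<gamma>. \<gamma> t) -` S \<inter> curves"
    proof
      fix g assume "g \<in> Metric_space.mball curves (mdist curve_metric) f r"
      then have g: "g \<in> curves" "mdist curve_metric f g < r"
        by (auto simp: Metric_space.in_mball[OF Metric_space_mspace_mdist])
      then have "dist (f t) (g t) < r" using lip[of f g] f by auto
      then show "g \<in> (\<lambda>\<gamma>. \<gamma> t) -` S \<inter> curves" using r g by auto
    qed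
    then show "\<exists>r>0. Metric_space.mball curves (mdist curve_metric) f r
                 \<subseteq> (\<lambda>\<gamma>. \<gamma> t) -` S \<inter> curves"
      using r by blast
  qed auto
  with pow show "(\<lambda>\<gamma>. \<gamma> t) -` S \<inter> space borel_curves \<in> sets borel_curves"
    unfolding sp by (auto simp: borel_curves_def sets_measure_of)
qed

definition Geo :: "(real \<Rightarrow> 'a::metric_space) set" where
  "Geo = {\<gamma> \<in> curves. \<forall>s\<in>{0..1}. \<forall>t\<in>{0..1}. dist (\<gamma> s) (\<gamma> t) = \<bar>s - t\<bar> * dist (\<gamma> 0) (\<gamma> 1)}"

definition geodesic_space :: "'a::metric_space itself \<Rightarrow> bool" where
  "geodesic_space _ \<longleftrightarrow> (\<forall>x y :: 'a. \<exists>\<gamma>\<in>Geo. \<gamma> 0 = x \<and> \<gamma> 1 = y)"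

text \<open>The metric derivative; it exists at almost every time of an absolutely continuous curve.\<close>

definition metric_speed :: "(real \<Rightarrow> 'a::metric_space) \<Rightarrow> real \<Rightarrow> real" where
  "metric_speed \<gamma> t = Lim (at t within {0..1}) (\<lambda>s. dist (\<gamma> s) (\<gamma> t) / \<bar>s - t\<bar>)"

section \<open>Optimal transport\<close>

definition borel_prob :: "'a::topological_space measure set" where
  "borel_prob = {\<mu>. sets \<mu> = sets borel \<and> prob_space \<mu>}"

definition P2 :: "'a::polish_space measure set" where
  "P2 = {\<mu> \<in> borel_prob. \<exists>x0. (\<integral>\<^sup>+x. ennreal ((dist x0 x)\<^sup>2) \<partial>\<mu>) < \<infinity>}"

definition Pcm :: "'a::polish_space measure \<Rightarrow> 'a measure set" where
  "Pcm m = {\<mu> \<in> borel_prob. compact (measure_support \<mu>) \<and> absolutely_continuous m \<mu>}"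

definition couplings :: "'a::polish_space measure \<Rightarrow> 'a measure \<Rightarrow> ('a \<times> 'a) measure set" where
  "couplings \<mu> \<nu> = {q. sets q = sets (borel \<Otimes>\<^sub>M borel) \<and> distr q borel fst = \<mu> \<and> distr q borel snd = \<nu>}"

text \<open>On \<open>P2\<close> the infimum is finite, so the conversion to a real number loses nothing.\<close>

definition W2 :: "'a::polish_space measure \<Rightarrow> 'a measure \<Rightarrow> real" where
  "W2 \<mu> \<nu> = sqrt (enn2real (INF q\<in>couplings \<mu> \<nu>. \<integral>\<^sup>+z. ennreal ((dist (fst z) (snd z))\<^sup>2) \<partial>q))"

definition OptGeo :: "'a::polish_space measure \<Rightarrow> 'a measure \<Rightarrow> (real \<Rightarrow> 'a) measure set" where
  "OptGeo \<mu>0 \<mu>1 = {\<pi>. sets \<pi> = sets borel_curves \<and> prob_space \<pi> \<and> (AE \<gamma> in \<pi>. \<gamma> \<in> Geo)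
     \<and> distr \<pi> borel (\<lambda>\<gamma>. \<gamma> 0) = \<mu>0 \<and> distr \<pi> borel (\<lambda>\<gamma>. \<gamma> 1) = \<mu>1
     \<and> ennreal ((W2 \<mu>0 \<mu>1)\<^sup>2)
         = (\<integral>\<^sup>+\<gamma>. (\<integral>\<^sup>+t\<in>{0..1}. ennreal ((metric_speed \<gamma> t)\<^sup>2) \<partial>lborel) \<partial>\<pi>)}"

definition monge_space :: "'a::polish_space measure \<Rightarrow> bool" where
  "monge_space m \<longleftrightarrow> (\<forall>\<mu>0\<in>P2. \<forall>\<mu>1\<in>P2. absolutely_continuous m \<mu>0 \<longrightarrow>
     (\<exists>\<pi>. OptGeo \<mu>0 \<mu>1 = {\<pi>}
        \<and> (\<exists>T \<in> borel \<rightarrow>\<^sub>M borel_curves. range T \<subseteq> Geo \<and> \<pi> = distr \<mu>0 borel_curves T)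
        \<and> (\<forall>t\<in>{0..<1}. absolutely_continuous m (distr \<pi> borel (\<lambda>\<gamma>. \<gamma> t)))))"

section \<open>Distortion coefficients and the QCD condition\<close>

text \<open>
  Real powers on the extended half-line, with \<open>0\<close> to a negative power equal to \<open>\<infinity>\<close>
  and \<open>\<infinity>\<close> to a negative power equal to \<open>0\<close>, unlike \<open>powr\<close> on the reals.
\<close>

definition ennpowr :: "ennreal \<Rightarrow> real \<Rightarrow> ennreal" where
  "ennpowr x p =
     (if p = 0 then 1
      else if x = 0 then (if p < 0 then \<infinity> else 0)
      else if x = \<infinity> then (if p < 0 then 0 else \<infinity>)
      else ennreal (enn2real x powr p))"

definition sigma_coeff :: "real \<Rightarrow> real \<Rightarrow> real \<Rightarrow> real \<Rightarrow> ennreal" where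
  "sigma_coeff K M t \<theta> =
     (let \<kappa> = K / M in
      if K = 0 \<or> \<theta> = 0 then ennreal t
      else if K > 0 then
        (if \<theta> < pi / sqrt \<kappa> then ennreal (sin (t * \<theta> * sqrt \<kappa>) / sin (\<theta> * sqrt \<kappa>)) else \<infinity>)
      else ennreal (sinh (t * \<theta> * sqrt (- \<kappa>)) / sinh (\<theta> * sqrt (- \<kappa>))))"

definition tau_coeff :: "real \<Rightarrow> real \<Rightarrow> real \<Rightarrow> real \<Rightarrow> ennreal" where
  "tau_coeff K N t \<theta> = ennreal (t powr (1 / N)) * ennpowr (sigma_coeff K (N - 1) t \<theta>) (1 - 1 / N)"

text \<open>
  The density \<open>\<rho>\<^sub>t\<close> is \<open>RN_deriv m (distr \<pi> borel (\<lambda>\<gamma>. \<gamma> t))\<close>.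
  On a Monge space \<open>OptGeo \<mu>0 \<mu>1\<close> is a singleton, so the quantifier over \<open>\<pi>\<close> picks its element.
\<close>

definition QCD :: "'a::polish_space measure \<Rightarrow> real \<Rightarrow> real \<Rightarrow> real \<Rightarrow> bool" where
  "QCD m Q K N \<longleftrightarrow> (\<forall>\<mu>0\<in>Pcm m. \<forall>\<mu>1\<in>Pcm m. \<forall>\<pi>\<in>OptGeo \<mu>0 \<mu>1. \<forall>t\<in>{0<..<1}.
     let \<rho> = (\<lambda>s. RN_deriv m (distr \<pi> borel (\<lambda>\<gamma>. \<gamma> s))) in
     AE \<gamma> in \<pi>. ennpowr (\<rho> t (\<gamma> t)) (- 1 / N) \<ge>
       ennreal (Q powr (- 1 / N)) *
         (tau_coeff K N (1 - t) (dist (\<gamma> 0) (\<gamma> 1)) * ennpowr (\<rho> 0 (\<gamma> 0)) (- 1 / N)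
          + tau_coeff K N t (dist (\<gamma> 0) (\<gamma> 1)) * ennpowr (\<rho> 1 (\<gamma> 1)) (- 1 / N)))"

section \<open>Cheeger energy and weak minimal upper gradients\<close>

text \<open>At an isolated point the filter \<open>at x\<close> is \<open>bot\<close>, whose \<open>Limsup\<close> in \<open>ennreal\<close> is \<open>0\<close>.\<close>

definition metric_slope :: "('a::metric_space \<Rightarrow> real) \<Rightarrow> 'a \<Rightarrow> ennreal" where
  "metric_slope f x = Limsup (at x) (\<lambda>y. ennreal (\<bar>f y - f x\<bar> / dist x y))"

definition Lip_bs :: "('a::metric_space \<Rightarrow> real) set" where
  "Lip_bs = {f. (\<exists>L. L-lipschitz_on UNIV f) \<and> bounded {x. f x \<noteq> 0}}"

definition L2 :: "'a measure \<Rightarrow> ('a \<Rightarrow> real) set" where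
  "L2 m = {f \<in> borel_measurable m. integrable m (\<lambda>x. (f x)\<^sup>2)}"

definition Linfty :: "'a measure \<Rightarrow> ('a \<Rightarrow> real) set" where
  "Linfty m = {f \<in> borel_measurable m. \<exists>C. AE x in m. \<bar>f x\<bar> \<le> C}"

definition L2_norm :: "'a measure \<Rightarrow> ('a \<Rightarrow> real) \<Rightarrow> real" where
  "L2_norm m f = sqrt (\<integral>x. (f x)\<^sup>2 \<partial>m)"

definition L2_tendsto :: "'a measure \<Rightarrow> (nat \<Rightarrow> 'a \<Rightarrow> real) \<Rightarrow> ('a \<Rightarrow> real) \<Rightarrow> bool" where
  "L2_tendsto m F f \<longleftrightarrow> (\<forall>n. F n \<in> L2 m) \<and> f \<in> L2 m \<and>
     (\<lambda>n. L2_norm m (\<lambda>x. F n x - f x)) \<longlonglongrightarrow> 0"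

definition L2_weakly_tendsto :: "'a measure \<Rightarrow> (nat \<Rightarrow> 'a \<Rightarrow> real) \<Rightarrow> ('a \<Rightarrow> real) \<Rightarrow> bool" where
  "L2_weakly_tendsto m F f \<longleftrightarrow> (\<forall>n. F n \<in> L2 m) \<and> f \<in> L2 m \<and>
     (\<forall>h\<in>L2 m. (\<lambda>n. \<integral>x. F n x * h x \<partial>m) \<longlonglongrightarrow> (\<integral>x. f x * h x \<partial>m))"

definition Ch :: "'a::metric_space measure \<Rightarrow> ('a \<Rightarrow> real) \<Rightarrow> ennreal" where
  "Ch m f = (INF F\<in>{F. (\<forall>n. F n \<in> Lip_bs) \<and> L2_tendsto m F f}.
     liminf (\<lambda>n. \<integral>\<^sup>+x. (metric_slope (F n) x)\<^sup>2 \<partial>m))"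

definition W12 :: "'a::metric_space measure \<Rightarrow> ('a \<Rightarrow> real) set" where
  "W12 m = {f \<in> L2 m. Ch m f < \<infinity>}"

definition relaxed_gradients :: "'a::metric_space measure \<Rightarrow> ('a \<Rightarrow> real) \<Rightarrow> ('a \<Rightarrow> real) set" where
  "relaxed_gradients m f = {g. \<exists>F. (\<forall>n. F n \<in> Lip_bs) \<and> L2_tendsto m F f \<and>
     L2_weakly_tendsto m (\<lambda>n x. enn2real (metric_slope (F n) x)) g}"

text \<open>
  \<open>|Df|\<^sub>w\<close> is an element of \<open>L\<^sup>2(m)\<close>, that is, a class of functions modulo equality almost
  everywhere; \<open>is_weak_min_upper_gradient m f g\<close> says that \<open>g\<close> represents it.
\<close>

definition is_weak_min_upper_gradient ::
    "'a::metric_space measure \<Rightarrow> ('a \<Rightarrow> real) \<Rightarrow> ('a \<Rightarrow> real) \<Rightarrow> bool" where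
  "is_weak_min_upper_gradient m f g \<longleftrightarrow> g \<in> relaxed_gradients m f \<and>
     (\<forall>h\<in>relaxed_gradients m f. L2_norm m g \<le> L2_norm m h)"

end

theory Submission
  imports Defs
begin

text \<open>
  Let \<open>A\<close> and \<open>B\<close> be compact sets of positive measure, and \<open>\<pi>\<close> the optimal plan between their
  normalised restrictions of \<open>m\<close>. Distances between \<open>A\<close> and \<open>B\<close> are bounded, say by \<open>D\<close>, so
  \<open>\<tau>\<^sup>(\<^sup>t\<^sup>)\<close> dominates a positive multiple of \<open>t\<close>, and QCD bounds the densities of all intermediate
  measures by one constant. Hence the law \<open>\<nu>\<close> of \<open>\<gamma>\<^sub>t\<close>, with \<open>t\<close> uniform in \<open>[0,1]\<close>, has a bounded
  density, which may be tested against the weakly convergent slopes of Lipschitz functions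
  \<open>F\<^sub>n \<longlonglongrightarrow> f\<close>. Integrating \<open>F\<^sub>n (\<gamma> 1) - F\<^sub>n (\<gamma> 0) \<le> D * \<integral> \<bar>DF\<^sub>n\<bar>(\<gamma> t) dt\<close> and letting \<open>n\<close> tend to
  infinity shows that the averages of \<open>f\<close> over \<open>B\<close> and \<open>A\<close> differ by at most \<open>D\<close>. Taking for \<open>A\<close>
  and \<open>B\<close> subsets of sublevel and superlevel sets of \<open>f\<close> in small balls, \<open>f\<close> is 1-Lipschitz off the
  union of all such sets that are null, where levels and radii are rational and the centres range
  over a countable dense set.
\<close>

section \<open>Lipschitz functions along geodesics\<close>

abbreviation unit_lborel :: "real measure" where
  "unit_lborel \<equiv> restrict_space lborel {0..1}"

lemma prob_space_unit_lborel: "prob_space unit_lborel"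
  by (intro prob_space_restrict_space) auto

text \<open>Integrating against an antiderivative \<open>\<Phi>\<close> of \<open>\<phi>\<close>
  moves the difference quotient from \<open>\<phi>\<close> onto \<open>\<Phi>\<close>: the integral
  is the quotient of \<open>\<Phi>\<close> at \<open>1\<close> minus the one at \<open>0\<close>.
  Thus only continuity of \<open>\<phi>\<close> enters.\<close>

lemma difference_quotient_integral_tendsto:
  fixes \<phi> :: "real \<Rightarrow> real"
  assumes cont: "continuous_on UNIV \<phi>"
  shows "(\<lambda>k. \<integral>t. real (Suc k) * (\<phi> (t + 1 / real (Suc k)) - \<phi> t) \<partial>unit_lborel) \<longlonglongrightarrow> \<phi> 1 - \<phi> 0"
proof -
  obtain \<Phi> where \<Phi>: "\<And>x. x \<in> {-1..3} \<Longrightarrow> (\<Phi> has_vector_derivative \<phi> x) (at x within {-1..3})"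
    using antiderivative_continuous[of "-1" 3 \<phi>] cont continuous_on_subset by blast
  have D: "(\<Phi> has_real_derivative \<phi> x) (at x)" if "x \<in> {-1<..<3}" for x
    using \<Phi>[of x] that at_within_open[of x "{-1<..<3}"]
    by (metis (no_types) at_within_Icc_at has_real_derivative_iff_has_vector_derivative
        greaterThanLessThan_iff greaterThanLessThan_subseteq_atLeastAtMost_iff order_refl subsetD)
  have FTC: "(\<integral>t. \<phi> (t + h) \<partial>unit_lborel) = \<Phi> (1 + h) - \<Phi> h"
      "integrable unit_lborel (\<lambda>t. \<phi> (t + h))" if "0 \<le> h" "h \<le> 1" for h
  proof -
    have c: "continuous_on {0..1} (\<lambda>t. \<phi> (t + h))"
      by (intro continuous_on_compose2[OF cont] continuous_intros) auto
    have d: "((\<lambda>t. \<Phi> (t + h)) has_vector_derivative \<phi> (t + h)) (at t within {0..1})"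
      if "0 \<le> t" "t \<le> 1" for t
      using DERIV_shift[of \<Phi> "\<phi> (t + h)" t h] D[of "t + h"] that \<open>0 \<le> h\<close> \<open>h \<le> 1\<close>
      by (auto intro: has_vector_derivative_at_within simp: has_real_derivative_iff_has_vector_derivative)
    have "has_bochner_integral lborel (\<lambda>x. indicator {0..1} x *\<^sub>R \<phi> (x + h)) (\<Phi> (1 + h) - \<Phi> (0 + h))"
      using has_bochner_integral_FTC_Icc[OF _ d c] by simp
    then show "(\<integral>t. \<phi> (t + h) \<partial>unit_lborel) = \<Phi> (1 + h) - \<Phi> h"
      "integrable unit_lborel (\<lambda>t. \<phi> (t + h))"
      by (auto simp: integral_restrict_space integrable_restrict_space has_bochner_integral_iff)
  qed
  have q: "(\<lambda>k. (\<Phi> (x + 1 / real (Suc k)) - \<Phi> x) / (1 / real (Suc k))) \<longlonglongrightarrow> \<phi> x" if "x \<in> {0, 1}" for x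
  proof -
    have "((\<lambda>h. (\<Phi> (x + h) - \<Phi> x) / h) \<longlongrightarrow> \<phi> x) (at 0)"
      using D[of x] that by (auto simp: DERIV_def)
    moreover have "filterlim (\<lambda>k. 1 / real (Suc k)) (at 0) sequentially"
      unfolding filterlim_at using LIMSEQ_Suc[OF lim_1_over_n] by (auto simp: eventually_sequentially)
    ultimately show ?thesis by (rule filterlim_compose)
  qed
  have "(\<integral>t. real (Suc k) * (\<phi> (t + 1 / real (Suc k)) - \<phi> t) \<partial>unit_lborel)
     = (\<Phi> (1 + 1 / real (Suc k)) - \<Phi> 1) / (1 / real (Suc k))
       - (\<Phi> (0 + 1 / real (Suc k)) - \<Phi> 0) / (1 / real (Suc k))" for k
    using FTC[of "1 / real (Suc k)"] FTC[of 0] by (simp add: right_diff_distrib mult.commute del: of_nat_Suc)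
  then show ?thesis
    using tendsto_diff[OF q[of 1] q[of 0]] by simp
qed

text \<open>Replaces the fundamental theorem of calculus when only a bound \<open>\<psi>\<close> for
  the upper limit of the right difference quotients is at hand. By the preceding lemma their
  integrals converge to the increment, and the Lipschitz constant dominates them.\<close>

lemma increment_le_integral_upper_derivative:
  fixes \<phi> \<psi> :: "real \<Rightarrow> real"
  assumes lip: "L-lipschitz_on UNIV \<phi>"
    and [measurable]: "\<psi> \<in> borel_measurable borel"
    and bound: "\<And>t. \<bar>\<psi> t\<bar> \<le> C"
    and upper: "\<And>t c. 0 \<le> t \<Longrightarrow> t < 1 \<Longrightarrow> \<psi> t < c \<Longrightarrow>
      eventually (\<lambda>k. real (Suc k) * (\<phi> (t + 1 / real (Suc k)) - \<phi> t) \<le> c) sequentially"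
  shows "\<phi> 1 - \<phi> 0 \<le> (\<integral>t. \<psi> t \<partial>unit_lborel)"
proof -
  interpret U: prob_space unit_lborel by (rule prob_space_unit_lborel)
  define q where "q k t = real (Suc k) * (\<phi> (t + 1 / real (Suc k)) - \<phi> t)" for k t
  have cont: "continuous_on UNIV \<phi>" using lip by (rule lipschitz_on_continuous_on)
  have [measurable]: "\<phi> \<in> borel_measurable borel"
    using cont by (rule borel_measurable_continuous_onI)
  have L: "\<bar>q k t\<bar> \<le> L" for k t
    using lipschitz_onD[OF lip, of "t + 1 / real (Suc k)" t]
    by (simp add: q_def dist_real_def abs_mult pos_le_divide_eq mult.commute del: of_nat_Suc)
  have C: "0 \<le> C" using bound[of 0] by linarith
  have qm[measurable]: "q k \<in> borel_measurable borel" for k unfolding q_def by measurable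
  \<comment> \<open>The endpoint \<open>1\<close>, about which \<open>upper\<close> says nothing, is
    a null set.\<close>
  have ae: "AE t in unit_lborel. 0 \<le> t \<and> t < 1"
    using AE_lborel_singleton[of 1] by (auto simp: AE_restrict_space_iff)
  \<comment> \<open>The quotients \<open>q k\<close> need not converge, but an upper limit at most \<open>\<psi>\<close> means
    \<open>max (q k) \<psi> \<longlonglongrightarrow> \<psi>\<close>, so dominated convergence applies to the maximum.\<close>
  have "(\<lambda>k. \<integral>t. max (q k t) (\<psi> t) \<partial>unit_lborel) \<longlonglongrightarrow> (\<integral>t. \<psi> t \<partial>unit_lborel)"
  proof (rule integral_dominated_convergence[where w = "\<lambda>_. max L C"])
    show "AE t in unit_lborel. (\<lambda>k. max (q k t) (\<psi> t)) \<longlonglongrightarrow> \<psi> t"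
      using ae
    proof eventually_elim
      case (elim t)
      show ?case
      proof (rule order_tendstoI)
        fix a assume "\<psi> t < a"
        then obtain c where c: "\<psi> t < c" "c < a" using dense by blast
        then show "\<forall>\<^sub>F k in sequentially. max (q k t) (\<psi> t) < a"
          using upper[of t c] elim by (auto simp: q_def elim!: eventually_mono)
      qed (auto simp: less_max_iff_disj)
    qed
    show "AE t in unit_lborel. norm (max (q k t) (\<psi> t)) \<le> max L C" for k
      using L[of k] bound by (intro AE_I2) (smt (verit) real_norm_def)
  qed (auto simp: measurable_restrict_space1)
  moreover have "(\<integral>t. q k t \<partial>unit_lborel) \<le> (\<integral>t. max (q k t) (\<psi> t) \<partial>unit_lborel)" for k
  proof (rule integral_mono)
    show "integrable unit_lborel (q k)"
      using L[of k] by (intro U.integrable_const_bound[of _ L]) (auto simp: measurable_restrict_space1)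
    show "integrable unit_lborel (\<lambda>t. max (q k t) (\<psi> t))"
    proof (rule U.integrable_const_bound[of _ "max L C"])
      show "AE t in unit_lborel. norm (max (q k t) (\<psi> t)) \<le> max L C"
        using L[of k] bound by (intro AE_I2) (smt (verit) real_norm_def)
    qed (auto simp: measurable_restrict_space1)
  qed auto
  ultimately show ?thesis
    using LIMSEQ_le[OF difference_quotient_integral_tendsto[OF cont]] unfolding q_def by blast
qed

text \<open>A geodesic moves by exactly \<open>1/(k+1)\<close> times its length, and a strict bound
  on the slope holds as a bound on the quotients in a whole small ball, which the moved point
  eventually enters.\<close>

lemma geodesic_increment_quotient_le:
  fixes \<gamma> :: "real \<Rightarrow> 'a::metric_space" and F :: "'a \<Rightarrow> real"
  assumes "\<gamma> \<in> Geo" and "0 \<le> t" "t < 1"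
    and lt: "metric_slope F (\<gamma> t) < ennreal c" and D: "dist (\<gamma> 0) (\<gamma> 1) \<le> D"
  shows "eventually (\<lambda>k. real (Suc k) * (F (\<gamma> (t + 1 / real (Suc k))) - F (\<gamma> t)) \<le> D * c) sequentially"
proof -
  \<comment> \<open>For \<open>c \<le> 0\<close> the number \<open>ennreal c\<close> is
    \<open>0\<close>, and nothing lies strictly below it.\<close>
  have c: "0 < c" using lt by (cases "0 < c") (simp_all add: ennreal_neg)
  let ?h = "\<lambda>k. 1 / real (Suc k)"
  let ?l = "dist (\<gamma> 0) (\<gamma> 1)"
  have speed: "\<And>s t. 0 \<le> s \<Longrightarrow> s \<le> 1 \<Longrightarrow> 0 \<le> t \<Longrightarrow> t \<le> 1 \<Longrightarrow> dist (\<gamma> s) (\<gamma> t) = \<bar>s - t\<bar> * ?l"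
    using assms(1) unfolding Geo_def mem_Collect_eq Ball_def atLeastAtMost_iff by blast
  have "eventually (\<lambda>y. ennreal (\<bar>F y - F (\<gamma> t)\<bar> / dist (\<gamma> t) y) < ennreal c) (at (\<gamma> t))"
    using lt unfolding metric_slope_def by (rule Limsup_lessD)
  then obtain d where d: "d > 0"
    "\<And>y. y \<noteq> \<gamma> t \<Longrightarrow> dist y (\<gamma> t) < d \<Longrightarrow> \<bar>F y - F (\<gamma> t)\<bar> / dist (\<gamma> t) y < c"
    unfolding eventually_at by (auto simp: ennreal_less_iff)
  \<comment> \<open>In product form the bound also holds at the centre, which takes care of constant
    geodesics.\<close>
  have bound: "\<bar>F y - F (\<gamma> t)\<bar> \<le> c * dist (\<gamma> t) y" if "dist y (\<gamma> t) < d" for y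
    using d(2)[of y] that by (cases "y = \<gamma> t") (auto simp: field_simps)
  have "(\<lambda>k. ?h k * ?l) \<longlonglongrightarrow> 0"
    using tendsto_mult_left_zero[OF LIMSEQ_Suc[OF lim_1_over_n]] by auto
  then have "eventually (\<lambda>k. ?h k * ?l < d) sequentially"
    using d(1) order_tendstoD(2) by blast
  moreover have "eventually (\<lambda>k. ?h k < 1 - t) sequentially"
    using order_tendstoD(2)[OF LIMSEQ_Suc[OF lim_1_over_n], of "1 - t"] \<open>t < 1\<close> by simp
  ultimately show ?thesis
  proof eventually_elim
    case (elim k)
    have e: "dist (\<gamma> (t + ?h k)) (\<gamma> t) = ?h k * ?l"
      using speed[of "t + ?h k" t] elim assms(2,3) by simp
    have "F (\<gamma> (t + ?h k)) - F (\<gamma> t) \<le> c * (?h k * ?l)"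
      using bound[of "\<gamma> (t + ?h k)"] e elim by (simp add: dist_commute)
    also have "\<dots> \<le> c * (?h k * D)" using D c by (intro mult_left_mono) auto
    finally show ?case by (simp add: field_simps)
  qed
qed

text \<open>Makes slopes finite, so that \<open>enn2real\<close> keeps their value, and gives the
  uniform bound needed for domination along a geodesic.\<close>

lemma metric_slope_le_lipschitz:
  assumes "L-lipschitz_on UNIV F"
  shows "metric_slope F x \<le> ennreal L"
  unfolding metric_slope_def
proof (rule Limsup_bounded, rule always_eventually, rule allI)
  fix y
  have "\<bar>F y - F x\<bar> \<le> L * dist x y"
    using lipschitz_onD[OF assms, of y x] by (simp add: dist_real_def dist_commute)
  then show "ennreal (\<bar>F y - F x\<bar> / dist x y) \<le> ennreal L"
    using lipschitz_on_nonneg[OF assms]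
    by (intro ennreal_leI) (cases "x = y", simp_all add: pos_divide_le_eq)
qed

lemma geodesic_lipschitz:
  assumes "\<gamma> \<in> Geo"
  shows "(dist (\<gamma> 0) (\<gamma> 1))-lipschitz_on {0..1} \<gamma>"
proof (rule lipschitz_onI)
  fix s t :: real assume "s \<in> {0..1}" "t \<in> {0..1}"
  then have "dist (\<gamma> s) (\<gamma> t) = \<bar>s - t\<bar> * dist (\<gamma> 0) (\<gamma> 1)"
    using assms unfolding Geo_def by blast
  then show "dist (\<gamma> s) (\<gamma> t) \<le> dist (\<gamma> 0) (\<gamma> 1) * dist s t"
    by (metis dist_real_def mult.commute order_refl)
qed simp

lemma clamp_lipschitz: "1-lipschitz_on UNIV (\<lambda>t::real. max 0 (min 1 t))"
  by (auto simp: lipschitz_on_def dist_real_def)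

text \<open>Precomposing with the clamp to \<open>[0,1]\<close> turns \<open>F \<circ> \<gamma>\<close> into a Lipschitz function on the line.\<close>

lemma geodesic_upper_gradient:
  fixes \<gamma> :: "real \<Rightarrow> 'a::metric_space" and F :: "'a \<Rightarrow> real"
  assumes \<gamma>: "\<gamma> \<in> Geo" and F: "L-lipschitz_on UNIV F"
    and [measurable]: "(\<lambda>x. enn2real (metric_slope F x)) \<in> borel_measurable borel"
    and D: "dist (\<gamma> 0) (\<gamma> 1) \<le> D"
  shows "F (\<gamma> 1) - F (\<gamma> 0) \<le> D * (\<integral>t. enn2real (metric_slope F (\<gamma> t)) \<partial>unit_lborel)"
proof -
  let ?c = "\<lambda>t::real. max 0 (min 1 t)"
  let ?G = "\<lambda>t. enn2real (metric_slope F (\<gamma> (?c t)))"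
  have D0: "0 \<le> D" using D zero_le_dist[of "\<gamma> 0" "\<gamma> 1"] by linarith
  have L0: "0 \<le> L" using lipschitz_on_nonneg[OF F] .
  have "(dist (\<gamma> 0) (\<gamma> 1) * 1)-lipschitz_on UNIV (\<lambda>t. \<gamma> (?c t))"
    by (rule lipschitz_on_compose2[OF clamp_lipschitz])
       (rule lipschitz_on_subset[OF geodesic_lipschitz[OF \<gamma>]], auto)
  then have \<gamma>c: "(dist (\<gamma> 0) (\<gamma> 1))-lipschitz_on UNIV (\<lambda>t. \<gamma> (?c t))" by simp
  have [measurable]: "(\<lambda>t. \<gamma> (?c t)) \<in> borel_measurable borel"
    by (rule borel_measurable_continuous_onI[OF lipschitz_on_continuous_on[OF \<gamma>c]])
  have lip: "(L * dist (\<gamma> 0) (\<gamma> 1))-lipschitz_on UNIV (\<lambda>t. F (\<gamma> (?c t)))"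
    by (rule lipschitz_on_compose2[OF \<gamma>c]) (rule lipschitz_on_subset[OF F], auto)
  have le: "enn2real (metric_slope F x) \<le> L" for x
    using metric_slope_le_lipschitz[OF F, of x] L0 enn2real_leI by blast
  have fin: "metric_slope F x < \<top>" for x
    using metric_slope_le_lipschitz[OF F, of x] by (simp add: le_less_trans)
  have "F (\<gamma> (?c 1)) - F (\<gamma> (?c 0)) \<le> (\<integral>t. D * ?G t \<partial>unit_lborel)"
  proof (rule increment_le_integral_upper_derivative[OF lip, where C = "D * L"])
    show "\<bar>D * ?G t\<bar> \<le> D * L" for t
      using le D0 by (auto simp: abs_mult intro!: mult_left_mono)
  next
    fix t c :: real assume t: "0 \<le> t" "t < 1" and c: "D * ?G t < c"
    \<comment> \<open>The slope must be compared with a number before the factor \<open>D\<close> is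
      applied: \<open>c / D\<close> serves unless \<open>D = 0\<close>, when any \<open>e\<close>
      above the slope does.\<close>
    obtain e where e: "?G t < e" "D * e \<le> c"
    proof (cases "D = 0")
      case True then show ?thesis using c that[of "?G t + 1"] by simp
    next
      case False
      then show ?thesis using c D0 that[of "c / D"] by (simp add: field_simps)
    qed
    have ct: "?c t = t" using t by auto
    have e0: "0 \<le> e" using e(1) enn2real_nonneg order_trans less_imp_le by blast
    have "metric_slope F (\<gamma> t) < ennreal e"
      using e(1) fin[of "\<gamma> t"] e0 ct
      by (metis enn2real_nonneg ennreal_enn2real ennreal_less_iff)
    then have "eventually (\<lambda>k. real (Suc k) * (F (\<gamma> (t + 1 / real (Suc k))) - F (\<gamma> t)) \<le> D * e) sequentially"
      using geodesic_increment_quotient_le[OF \<gamma> t _ D] by blast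
    \<comment> \<open>From then on the shifted time lies in \<open>[0,1]\<close> and the clamp
      leaves it alone.\<close>
    moreover have "eventually (\<lambda>k. 1 / real (Suc k) < 1 - t) sequentially"
      using order_tendstoD(2)[OF LIMSEQ_Suc[OF lim_1_over_n], of "1 - t"] t by simp
    ultimately show "eventually (\<lambda>k. real (Suc k) * (F (\<gamma> (?c (t + 1 / real (Suc k)))) - F (\<gamma> (?c t))) \<le> c) sequentially"
    proof eventually_elim
      case (elim k)
      have "?c (t + 1 / real (Suc k)) = t + 1 / real (Suc k)" using elim(2) t by auto
      then show ?case using elim(1) e(2) ct by simp
    qed
  qed measurable
  also have "\<dots> = D * (\<integral>t. ?G t \<partial>unit_lborel)" by simp
  also have "(\<integral>t. ?G t \<partial>unit_lborel) = (\<integral>t. enn2real (metric_slope F (\<gamma> t)) \<partial>unit_lborel)"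
    by (rule Bochner_Integration.integral_cong) (auto simp: space_restrict_space)
  finally show ?thesis by simp
qed

section \<open>Bounded compression\<close>

lemma space_borel_curves: "space borel_curves = (curves :: (real \<Rightarrow> 'a::metric_space) set)"
  unfolding borel_curves_def using openin_subset
  by (subst space_measure_of) fastforce+

text \<open>Rounding the time down to the grid of mesh \<open>1/(k+1)\<close> leaves countably many
  evaluations, each measurable, and continuity of the curves gives convergence. The clamp keeps the
  grid points of all integers \<open>i\<close> inside \<open>[0,1]\<close>.\<close>

lemma measurable_joint_evaluation:
  "(\<lambda>z. fst z (snd z)) \<in> borel_curves \<Otimes>\<^sub>M unit_lborel \<rightarrow>\<^sub>M (borel :: 'a::metric_space measure)"
proof (rule borel_measurable_LIMSEQ_metric)
  let ?M = "borel_curves \<Otimes>\<^sub>M unit_lborel :: ((real \<Rightarrow> 'a) \<times> real) measure"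
  let ?r = "\<lambda>k x. of_int \<lfloor>real (Suc k) * x\<rfloor> / real (Suc k)"
  let ?c = "\<lambda>t::real. max 0 (min 1 t)"
  have [measurable]: "snd \<in> ?M \<rightarrow>\<^sub>M (borel :: real measure)"
    by (rule measurable_compose[OF measurable_snd]) (simp add: measurable_restrict_space1)
  fix k
  show "(\<lambda>z. fst z (?c (?r k (snd z)))) \<in> ?M \<rightarrow>\<^sub>M (borel :: 'a measure)"
  proof (rule measurable_compose_countable[where f = "\<lambda>i z. fst z (?c (of_int i / real (Suc k)))"
        and g = "\<lambda>z. \<lfloor>real (Suc k) * snd z\<rfloor>"])
    show "(\<lambda>z. fst z (?c (of_int i / real (Suc k)))) \<in> ?M \<rightarrow>\<^sub>M borel" for i :: int
      by (rule measurable_compose[OF measurable_fst measurable_evaluation]) auto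
  qed measurable
next
  let ?r = "\<lambda>k x. of_int \<lfloor>real (Suc k) * x\<rfloor> / real (Suc k)"
  let ?c = "\<lambda>t::real. max 0 (min 1 t)"
  fix z :: "(real \<Rightarrow> 'a) \<times> real" assume "z \<in> space (borel_curves \<Otimes>\<^sub>M unit_lborel)"
  then have z: "fst z \<in> curves" "snd z \<in> {0..1}"
    by (auto simp: space_pair_measure space_borel_curves space_restrict_space)
  have "(\<lambda>k. ?r k (snd z)) \<longlonglongrightarrow> snd z"
  proof (rule tendsto_sandwich)
    show "\<forall>\<^sub>F k in sequentially. snd z - 1 / real (Suc k) \<le> ?r k (snd z)"
    proof (intro always_eventually allI)
      fix k
      have "real (Suc k) * snd z - 1 \<le> of_int \<lfloor>real (Suc k) * snd z\<rfloor>" by linarith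
      then have "(real (Suc k) * snd z - 1) / real (Suc k) \<le> ?r k (snd z)"
        by (rule divide_right_mono) simp
      then show "snd z - 1 / real (Suc k) \<le> ?r k (snd z)"
        by (simp add: diff_divide_distrib del: of_nat_Suc)
    qed
    show "\<forall>\<^sub>F k in sequentially. ?r k (snd z) \<le> snd z"
    proof (intro always_eventually allI)
      fix k
      have "of_int \<lfloor>real (Suc k) * snd z\<rfloor> \<le> real (Suc k) * snd z" by linarith
      then show "?r k (snd z) \<le> snd z"
        by (simp add: pos_divide_le_eq mult.commute del: of_nat_Suc)
    qed
    show "(\<lambda>k. snd z - 1 / real (Suc k)) \<longlonglongrightarrow> snd z"
      using tendsto_diff[OF tendsto_const LIMSEQ_Suc[OF lim_1_over_n]] by auto
  qed simp
  then have "(\<lambda>k. ?c (?r k (snd z))) \<longlonglongrightarrow> ?c (snd z)"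
    by (intro tendsto_intros)
  then show "(\<lambda>k. fst z (?c (?r k (snd z)))) \<longlonglongrightarrow> fst z (snd z)"
    using z by (intro continuous_on_tendsto_compose[of "{0..1}" "fst z"]) (auto simp: mem_curves_iff)
qed

section \<open>Lower bounds for the distortion coefficients\<close>

lemma sin_mult_ge:
  fixes x t :: real
  assumes "0 \<le> t" "t \<le> 1" "0 \<le> x" "x \<le> pi"
  shows "t * sin x \<le> sin (t * x)"
proof -
  have "sin (t * 0) - t * sin 0 \<le> sin (t * x) - t * sin x"
  proof (rule DERIV_nonneg_imp_nondecreasing[OF \<open>0 \<le> x\<close>])
    fix y assume y: "0 \<le> y" "y \<le> x"
    have "((\<lambda>x. sin (t * x) - t * sin x) has_real_derivative t * (cos (t * y) - cos y)) (at y)"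
      by (auto intro!: derivative_eq_intros simp: algebra_simps)
    moreover have "cos y \<le> cos (t * y)"
      using y assms by (intro cos_monotone_0_pi_le) (auto intro: mult_left_le_one_le)
    ultimately show "\<exists>d. ((\<lambda>x. sin (t * x) - t * sin x) has_real_derivative d) (at y) \<and> 0 \<le> d"
      using assms(1) by (intro exI conjI) (assumption, simp)
  qed
  then show ?thesis by simp
qed

lemma sinh_ge_self:
  fixes x :: real
  assumes "0 \<le> x"
  shows "x \<le> sinh x"
proof -
  have "sinh 0 - 0 \<le> sinh x - x"
  proof (rule DERIV_nonneg_imp_nondecreasing[OF assms])
    show "\<exists>d. ((\<lambda>x. sinh x - x) has_real_derivative d) (at y) \<and> 0 \<le> d" for y :: real
      using cosh_real_ge_1[of y] by (intro exI[of _ "cosh y - 1"]) (auto intro!: derivative_eq_intros)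
  qed
  then show ?thesis by simp
qed

lemma sinh_le_mult_cosh:
  fixes x :: real
  assumes "0 \<le> x"
  shows "sinh x \<le> x * cosh x"
proof -
  have "0 * cosh 0 - sinh 0 \<le> x * cosh x - sinh x"
  proof (rule DERIV_nonneg_imp_nondecreasing[OF assms])
    show "\<exists>d. ((\<lambda>x. x * cosh x - sinh x) has_real_derivative d) (at y) \<and> 0 \<le> d"
      if "0 \<le> y" for y :: real
      using that by (intro exI[of _ "y * sinh y"]) (auto intro!: derivative_eq_intros)
  qed
  then show ?thesis by simp
qed

text \<open>For \<open>K \<ge> 0\<close> the coefficient is at least \<open>t\<close>, by concavity
  of the sine on \<open>[0, pi]\<close>. For \<open>K < 0\<close> the estimates
  \<open>t * x \<le> sinh (t * x)\<close> and \<open>sinh x \<le> x * cosh x\<close> lose the factor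
  \<open>cosh x\<close>, which is monotone in \<open>\<theta>\<close>. The absolute value makes one
  constant serve both signs.\<close>

lemma sigma_coeff_ge:
  assumes "M > 0" "0 < t" "t < 1" "0 \<le> \<theta>" "\<theta> \<le> D"
  shows "ennreal (t / cosh (D * sqrt \<bar>K / M\<bar>)) \<le> sigma_coeff K M t \<theta>"
proof -
  let ?c = "cosh (D * sqrt \<bar>K / M\<bar>)"
  have c: "1 \<le> ?c" by (rule cosh_real_ge_1)
  have tc: "t / ?c \<le> t" using c assms(2) by (simp add: divide_le_eq)
  consider "K = 0 \<or> \<theta> = 0" | "K > 0" "\<theta> > 0" | "K < 0" "\<theta> > 0"
    using assms(4) by fastforce
  then show ?thesis
  proof cases
    case 1
    then show ?thesis using tc by (auto simp: sigma_coeff_def intro: ennreal_leI)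
  next
    case 2
    let ?x = "\<theta> * sqrt (K / M)"
    show ?thesis
    proof (cases "\<theta> < pi / sqrt (K / M)")
      case True
      then have x: "0 < ?x" "?x < pi"
        using 2 assms(1) by (auto simp: pos_less_divide_eq)
      then have "0 < sin ?x" by (rule sin_gt_zero)
      then have "t \<le> sin (t * ?x) / sin ?x"
        using sin_mult_ge[of t ?x] assms x by (simp add: pos_le_divide_eq)
      then show ?thesis
        using 2 True tc by (auto simp: sigma_coeff_def Let_def mult.assoc intro!: ennreal_leI)
    next
      case False
      then show ?thesis using 2 by (simp add: sigma_coeff_def Let_def)
    qed
  next
    case 3
    let ?s = "sqrt (- (K / M))" let ?x = "\<theta> * ?s"
    have s: "0 < ?s" using 3 assms(1) by (simp add: divide_neg_pos)
    have sc: "sqrt \<bar>K / M\<bar> = ?s" using 3 assms(1) by (simp add: abs_of_neg divide_neg_pos)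
    have x: "0 < ?x" using s 3 by simp
    have "sinh ?x \<le> ?x * cosh ?x" using x by (intro sinh_le_mult_cosh) simp
    also have "\<dots> \<le> ?x * ?c"
    proof -
      have "cosh ?x \<le> ?c"
        unfolding sc using s assms x by (subst cosh_real_nonneg_le_iff) (auto intro: mult_right_mono)
      then show ?thesis using x by (intro mult_left_mono) auto
    qed
    finally have "t * sinh ?x \<le> (t * ?x) * ?c"
      using assms(2) by (simp add: mult.assoc)
    also have "\<dots> \<le> sinh (t * ?x) * ?c"
      using sinh_ge_self[of "t * ?x"] x assms(2) c by (intro mult_right_mono) auto
    finally have "t / ?c \<le> sinh (t * ?x) / sinh ?x"
      using x c by (simp add: divide_simps mult.commute)
    then show ?thesis
      using 3 by (auto simp: sigma_coeff_def Let_def mult.assoc intro!: ennreal_leI)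
  qed
qed

lemma ennpowr_mono_real:
  assumes "0 < p" "0 < a" "ennreal a \<le> x"
  shows "ennreal (a powr p) \<le> ennpowr x p"
proof (cases "x = \<infinity>")
  case True
  then show ?thesis using assms by (simp add: ennpowr_def)
next
  case False
  then obtain r where r: "x = ennreal r" "0 \<le> r" by (cases x) auto
  with assms have "a \<le> r" by simp
  then show ?thesis
    using r assms by (auto simp: ennpowr_def intro!: ennreal_leI powr_mono2)
qed

text \<open>The exponents \<open>1/N\<close> and \<open>1 - 1/N\<close> add up to one, so the bound
  stays linear in \<open>t\<close>. As the hyperbolic cosine is at least \<open>1\<close>, its power
  \<open>1 - 1/N\<close> is no larger than itself.\<close>

lemma tau_coeff_ge:
  assumes "N > 1" "0 < t" "t < 1" "0 \<le> \<theta>" "\<theta> \<le> D"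
  shows "ennreal (t / cosh (D * sqrt \<bar>K / (N - 1)\<bar>)) \<le> tau_coeff K N t \<theta>"
proof -
  let ?c = "cosh (D * sqrt \<bar>K / (N - 1)\<bar>)"
  have c: "1 \<le> ?c" by (rule cosh_real_ge_1)
  have p: "0 < 1 - 1 / N" using assms(1) by simp
  have "?c powr (1 - 1 / N) \<le> ?c powr 1"
    using assms(1) c by (intro powr_mono) auto
  then have cp: "?c powr (1 - 1 / N) \<le> ?c" using c by simp
  have "t / ?c \<le> t / ?c powr (1 - 1 / N)"
    using cp c assms(2) by (intro divide_left_mono) auto
  also have "\<dots> = t powr (1 / N) * (t / ?c) powr (1 - 1 / N)"
    using assms(2) c by (simp add: powr_divide powr_add[symmetric])
  finally have "ennreal (t / ?c) \<le> ennreal (t powr (1 / N)) * ennreal ((t / ?c) powr (1 - 1 / N))"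
    by (simp add: ennreal_mult[symmetric] ennreal_leI)
  also have "\<dots> \<le> tau_coeff K N t \<theta>"
    unfolding tau_coeff_def
    using sigma_coeff_ge[of "N - 1" t \<theta> D K] assms c p
    by (intro mult_left_mono ennpowr_mono_real) auto
  finally show ?thesis .
qed

text \<open>Turns the lower bound that QCD gives for \<open>\<rho>\<close> to the power
  \<open>-1/N\<close> into an upper bound for \<open>\<rho>\<close>. The value
  \<open>x = \<infinity>\<close> is excluded because its negative power is
  \<open>0 < k\<close>.\<close>

lemma le_of_ennpowr_neg_ge:
  assumes "N > 0" "k > 0" "ennreal k \<le> ennpowr x (- 1 / N)"
  shows "x \<le> ennreal (k powr (- N))"
proof (cases "x = 0 \<or> x = \<infinity>")
  case True
  then show ?thesis using assms by (auto simp: ennpowr_def)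
next
  case False
  then obtain r where r: "x = ennreal r" "0 < r"
    by (cases x) (auto simp: less_le)
  then have "k \<le> r powr (- 1 / N)" using assms by (simp add: ennpowr_def)
  then have "(r powr (- 1 / N)) powr (- N) \<le> k powr (- N)"
    using assms by (intro powr_mono2') auto
  then show ?thesis using r assms by (auto simp: powr_powr intro: ennreal_leI)
qed

section \<open>Normalised restrictions of \<open>m\<close> and the density bound from QCD\<close>

lemma (in metric_measure_space) sigma_finite_measure_m: "sigma_finite_measure m"
proof
  show "\<exists>A. countable A \<and> A \<subseteq> sets m \<and> \<Union>A = space m \<and> (\<forall>a\<in>A. emeasure m a \<noteq> \<infinity>)"
  proof (intro exI conjI ballI)
    let ?A = "range (\<lambda>n. ball (undefined :: 'a) (real n))"
    show "?A \<subseteq> sets m" by (auto simp: sets_eq_borel)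
    show "\<Union>?A = space m"
      using reals_Archimedean2 sets_eq_imp_space_eq[OF sets_eq_borel] by auto
    show "emeasure m a \<noteq> \<infinity>" if "a \<in> ?A" for a
      using that finite_on_bounded[of a] by auto
  qed auto
qed

text \<open>\<open>RN_deriv\<close> is determined only almost everywhere; this identifies it where
  the normalised restriction lives, that is on \<open>A\<close>, as QCD requires at the end
  points.\<close>

lemma AE_uniform_measure_RN_deriv:
  assumes "sigma_finite_measure m" "A \<in> sets m" "emeasure m A \<noteq> 0" "emeasure m A \<noteq> \<infinity>"
  shows "AE x in uniform_measure m A. RN_deriv m (uniform_measure m A) x = 1 / emeasure m A"
proof -
  have "AE x in m. indicator A x / emeasure m A = RN_deriv m (uniform_measure m A) x"
    using assms(2) by (intro sigma_finite_measure.RN_deriv_unique[OF assms(1)])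
      (auto simp: uniform_measure_def)
  then have "AE x in m. x \<in> A \<longrightarrow> RN_deriv m (uniform_measure m A) x = 1 / emeasure m A"
    by eventually_elim (auto simp: indicator_def)
  then show ?thesis
    using assms by (subst AE_uniform_measure) (auto simp: less_top)
qed

lemma (in metric_measure_space) uniform_measure_compact:
  assumes "compact A" "emeasure m A > 0"
  shows "uniform_measure m A \<in> Pcm m" "uniform_measure m A \<in> P2" "emeasure m A < \<infinity>"
proof -
  have A: "A \<in> sets m" "A \<in> sets borel" using assms(1) by (auto simp: sets_eq_borel compact_imp_closed)
  show fin: "emeasure m A < \<infinity>"
    using finite_on_bounded A assms(1) compact_imp_bounded by blast
  have prob: "prob_space (uniform_measure m A)"
    using fin assms(2) by (intro prob_space_uniform_measure) auto
  then have bp: "uniform_measure m A \<in> borel_prob"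
    by (simp add: borel_prob_def sets_eq_borel)
  have AE_A: "AE x in uniform_measure m A. x \<in> A"
    using A by (intro AE_uniform_measureI) auto
  have ac: "absolutely_continuous m (uniform_measure m A)"
    using A unfolding uniform_measure_def by (intro absolutely_continuousI_density) auto
  have sub: "measure_support (uniform_measure m A) \<subseteq> A"
  proof
    fix x assume x: "x \<in> measure_support (uniform_measure m A)"
    show "x \<in> A"
    proof (rule ccontr)
      assume "x \<notin> A"
      then have "emeasure (uniform_measure m A) (- A) > 0"
        using x compact_imp_closed[OF assms(1)] by (auto simp: measure_support_def open_Compl)
      then show False using A sets_eq_borel by (simp add: emeasure_uniform_measure)
    qed
  qed
  \<comment> \<open>The complement of a support is the union of all null open sets; a closed subset
    of the compact \<open>A\<close> is compact.\<close>
  have "closed (measure_support (uniform_measure m A))"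
  proof -
    have "- measure_support \<mu> = \<Union>{U. open U \<and> emeasure \<mu> U = 0}" for \<mu> :: "'a measure"
      by (auto simp: measure_support_def)
    then show ?thesis by (metis (no_types, lifting) closed_def mem_Collect_eq open_Union)
  qed
  then have "compact (measure_support (uniform_measure m A))"
    using sub assms(1) compact_Int_closed inf.absorb2 by metis
  with bp ac show "uniform_measure m A \<in> Pcm m" by (simp add: Pcm_def)
  obtain x0 R where R: "\<And>x. x \<in> A \<Longrightarrow> dist x0 x \<le> R"
    using compact_imp_bounded[OF assms(1)] unfolding bounded_def by blast
  have "(\<integral>\<^sup>+x. ennreal ((dist x0 x)\<^sup>2) \<partial>uniform_measure m A) \<le> (\<integral>\<^sup>+x. ennreal (R\<^sup>2) \<partial>uniform_measure m A)"
    using AE_A by (intro nn_integral_mono_AE) (auto elim!: eventually_mono intro!: ennreal_leI power_mono R)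
  also have "\<dots> < \<infinity>" using prob_space.emeasure_space_1[OF prob] by (simp add: ennreal_mult_less_top)
  finally show "uniform_measure m A \<in> P2" using bp by (auto simp: P2_def)
qed

text \<open>What matters is that \<open>C\<close> is the same for all \<open>t\<close>, so that the
  bound survives averaging over time. The densities at both ends are constant, and the coefficients
  are bounded below by \<open>(1 - t) * c\<close> and \<open>t * c\<close>.\<close>

lemma (in metric_measure_space) QCD_bounded_compression:
  assumes mon: "monge_space m" and QCD: "QCD m Q K N" and QN: "Q \<ge> 1" "N > 1"
    and A: "compact A" "emeasure m A > 0" and B: "compact B" "emeasure m B > 0"
  obtains \<pi> C where "\<pi> \<in> OptGeo (uniform_measure m A) (uniform_measure m B)"
    "\<And>t E. t \<in> {0<..<1} \<Longrightarrow> E \<in> sets borel \<Longrightarrow>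
       emeasure (distr \<pi> borel (\<lambda>\<gamma>. \<gamma> t)) E \<le> ennreal C * emeasure m E"
proof -
  interpret sigma_finite_measure m by (rule sigma_finite_measure_m)
  let ?\<mu> = "uniform_measure m A" and ?\<nu> = "uniform_measure m B"
  note uA = uniform_measure_compact[OF A] and uB = uniform_measure_compact[OF B]
  have Am: "A \<in> sets m" "B \<in> sets m" using A B by (auto simp: sets_eq_borel compact_imp_closed)
  have "absolutely_continuous m ?\<mu>" using uA(1) by (simp add: Pcm_def)
  then have "\<exists>\<pi>. OptGeo ?\<mu> ?\<nu> = {\<pi>}
      \<and> (\<exists>T \<in> borel \<rightarrow>\<^sub>M borel_curves. range T \<subseteq> Geo \<and> \<pi> = distr ?\<mu> borel_curves T)
      \<and> (\<forall>t\<in>{0..<1}. absolutely_continuous m (distr \<pi> borel (\<lambda>\<gamma>. \<gamma> t)))"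
    using mon[unfolded monge_space_def, rule_format, OF uA(2) uB(2)] by simp
  then obtain \<pi> where "OptGeo ?\<mu> ?\<nu> = {\<pi>}"
    and ac: "\<And>t. t \<in> {0..<1} \<Longrightarrow> absolutely_continuous m (distr \<pi> borel (\<lambda>\<gamma>. \<gamma> t))"
    by (elim exE conjE) simp
  then have \<pi>: "\<pi> \<in> OptGeo ?\<mu> ?\<nu>" by simp
  have sets_\<pi>: "sets \<pi> = sets borel_curves" and d0: "distr \<pi> borel (\<lambda>\<gamma>. \<gamma> 0) = ?\<mu>"
    and d1: "distr \<pi> borel (\<lambda>\<gamma>. \<gamma> 1) = ?\<nu>"
    using \<pi> by (auto simp: OptGeo_def)
  have ev: "(\<lambda>\<gamma>. \<gamma> t) \<in> \<pi> \<rightarrow>\<^sub>M borel" if "t \<in> {0..1}" for t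
    using measurable_evaluation[OF that] by (subst measurable_cong_sets[OF sets_\<pi> refl])
  define a where "a = measure m A"
  define b where "b = measure m B"
  have ea: "emeasure m A = ennreal a"
    unfolding a_def using uA(3) by (intro emeasure_eq_ennreal_measure) auto
  have a: "0 < a" using A(2) unfolding ea by simp
  have eb: "emeasure m B = ennreal b"
    unfolding b_def using uB(3) by (intro emeasure_eq_ennreal_measure) auto
  have b: "0 < b" using B(2) unfolding eb by simp
  let ?e = "- 1 / N"
  \<comment> \<open>The end densities \<open>1/a\<close> and \<open>1/b\<close> to the power
    \<open>-1/N\<close>.\<close>
  define \<alpha> where "\<alpha> = (1 / a) powr ?e"
  define \<beta> where "\<beta> = (1 / b) powr ?e"
  have ab: "0 < \<alpha>" "0 < \<beta>" using a b by (auto simp: \<alpha>_def \<beta>_def)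
  have p\<alpha>: "ennpowr (1 / emeasure m A) ?e = ennreal \<alpha>"
    using a QN divide_ennreal[of 1 a] by (simp add: ea ennpowr_def \<alpha>_def)
  have p\<beta>: "ennpowr (1 / emeasure m B) ?e = ennreal \<beta>"
    using b QN divide_ennreal[of 1 b] by (simp add: eb ennpowr_def \<beta>_def)
  have "AE x in distr \<pi> borel (\<lambda>\<gamma>. \<gamma> 0). RN_deriv m ?\<mu> x = 1 / emeasure m A"
    unfolding d0 using AE_uniform_measure_RN_deriv[OF sigma_finite_measure_m Am(1)] A(2) uA(3) by auto
  then have r0: "AE \<gamma> in \<pi>. RN_deriv m ?\<mu> (\<gamma> 0) = 1 / emeasure m A"
    by (rule AE_distrD[OF ev, rotated]) simp
  have "AE x in distr \<pi> borel (\<lambda>\<gamma>. \<gamma> 1). RN_deriv m ?\<nu> x = 1 / emeasure m B"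
    unfolding d1 using AE_uniform_measure_RN_deriv[OF sigma_finite_measure_m Am(2)] B(2) uB(3) by auto
  then have r1: "AE \<gamma> in \<pi>. RN_deriv m ?\<nu> (\<gamma> 1) = 1 / emeasure m B"
    by (rule AE_distrD[OF ev, rotated]) simp
  have "AE x in distr \<pi> borel (\<lambda>\<gamma>. \<gamma> 0). x \<in> A"
    unfolding d0 using Am by (intro AE_uniform_measureI) auto
  then have g0: "AE \<gamma> in \<pi>. \<gamma> 0 \<in> A" by (rule AE_distrD[OF ev, rotated]) simp
  have "AE x in distr \<pi> borel (\<lambda>\<gamma>. \<gamma> 1). x \<in> B"
    unfolding d1 using Am by (intro AE_uniform_measureI) auto
  then have g1: "AE \<gamma> in \<pi>. \<gamma> 1 \<in> B" by (rule AE_distrD[OF ev, rotated]) simp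
  define D where "D = diameter (A \<union> B)"
  have D: "dist x y \<le> D" if "x \<in> A" "y \<in> B" for x y
    unfolding D_def using that A B by (intro diameter_bounded_bound) (auto simp: compact_imp_bounded)
  define c where "c = 1 / cosh (D * sqrt \<bar>K / (N - 1)\<bar>)"
  have c: "0 < c" using cosh_real_pos by (simp add: c_def)
  \<comment> \<open>The weights \<open>1 - t\<close> and \<open>t\<close> add up to one, so the
    combination of \<open>\<alpha>\<close> and \<open>\<beta>\<close> is at least their minimum and
    \<open>t\<close> drops out.\<close>
  define k where "k = Q powr ?e * (c * min \<alpha> \<beta>)"
  have k: "0 < k" using QN c ab by (simp add: k_def)
  have main: "emeasure (distr \<pi> borel (\<lambda>\<gamma>. \<gamma> t)) E \<le> ennreal (k powr (- N)) * emeasure m E"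
    if t: "t \<in> {0<..<1}" and E: "E \<in> sets borel" for t E
  proof -
    let ?\<mu>t = "distr \<pi> borel (\<lambda>\<gamma>. \<gamma> t)"
    let ?\<rho> = "RN_deriv m ?\<mu>t"
    let ?C = "ennreal (k powr (- N))"
    have tau: "ennreal (s * c) \<le> tau_coeff K N s \<theta>" if "0 < s" "s < 1" "0 \<le> \<theta>" "\<theta> \<le> D" for s \<theta>
      using tau_coeff_ge[OF QN(2) that, of K] by (simp add: c_def)
    have "AE \<gamma> in \<pi>. ennpowr (?\<rho> (\<gamma> t)) ?e \<ge>
       ennreal (Q powr ?e) *
         (tau_coeff K N (1 - t) (dist (\<gamma> 0) (\<gamma> 1)) * ennpowr (RN_deriv m ?\<mu> (\<gamma> 0)) ?e
          + tau_coeff K N t (dist (\<gamma> 0) (\<gamma> 1)) * ennpowr (RN_deriv m ?\<nu> (\<gamma> 1)) ?e)"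
      using QCD[unfolded QCD_def Let_def, rule_format, OF uA(1) uB(1) \<pi> t] unfolding d0 d1 .
    then have "AE \<gamma> in \<pi>. ?\<rho> (\<gamma> t) \<le> ?C"
      using r0 r1 g0 g1
    proof eventually_elim
      case (elim \<gamma>)
      let ?d = "dist (\<gamma> 0) (\<gamma> 1)"
      have d: "?d \<le> D" using D elim by blast
      have "c * min \<alpha> \<beta> = ((1 - t) * c) * min \<alpha> \<beta> + (t * c) * min \<alpha> \<beta>" by (simp add: algebra_simps)
      also have "\<dots> \<le> ((1 - t) * c) * \<alpha> + (t * c) * \<beta>"
        using t c by (intro add_mono mult_left_mono) auto
      finally have "k \<le> Q powr ?e * (((1 - t) * c) * \<alpha> + (t * c) * \<beta>)"
        unfolding k_def by (intro mult_left_mono) auto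
      then have "ennreal k \<le> ennreal (Q powr ?e * (((1 - t) * c) * \<alpha> + (t * c) * \<beta>))"
        by (rule ennreal_leI)
      also have "\<dots> = ennreal (Q powr ?e) * (ennreal ((1 - t) * c) * ennreal \<alpha> + ennreal (t * c) * ennreal \<beta>)"
        using t c ab by (simp add: ennreal_mult ennreal_plus)
      also have "\<dots> \<le> ennreal (Q powr ?e) *
         (tau_coeff K N (1 - t) ?d * ennpowr (RN_deriv m ?\<mu> (\<gamma> 0)) ?e
          + tau_coeff K N t ?d * ennpowr (RN_deriv m ?\<nu> (\<gamma> 1)) ?e)"
        unfolding elim(2,3) p\<alpha> p\<beta> using t d
        by (intro mult_left_mono add_mono mult_right_mono tau) auto
      also have "\<dots> \<le> ennpowr (?\<rho> (\<gamma> t)) ?e" by (rule elim(1))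
      finally show ?case using le_of_ennpowr_neg_ge k QN by auto
    qed
    moreover have evt: "(\<lambda>\<gamma>. \<gamma> t) \<in> \<pi> \<rightarrow>\<^sub>M borel" using ev[of t] t by auto
    moreover have \<rho>m[measurable]: "?\<rho> \<in> borel_measurable borel"
      using borel_measurable_RN_deriv[of m ?\<mu>t] by (subst (asm) measurable_cong_sets[OF sets_eq_borel refl])
    ultimately have AEt: "AE x in ?\<mu>t. ?\<rho> x \<le> ?C"
      by (subst AE_distr_iff) auto
    \<comment> \<open>Here part (c) of the Monge condition enters: absolute continuity makes
      \<open>?\<rho>\<close> a true density.\<close>
    have dens: "density m ?\<rho> = ?\<mu>t"
      using ac[of t] t sets_eq_borel by (intro density_RN_deriv) auto
    have Em: "E \<inter> {x. ?\<rho> x \<le> ?C} \<in> sets m" unfolding sets_eq_borel using E by measurable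
    \<comment> \<open>The bound on \<open>?\<rho>\<close> is known almost everywhere for
      \<open>?\<mu>t\<close>, not for \<open>m\<close>. Cutting \<open>E\<close> down to the set
      where it holds costs no \<open>?\<mu>t\<close>-mass and makes it available pointwise.\<close>
    have "emeasure ?\<mu>t E = emeasure ?\<mu>t (E \<inter> {x. ?\<rho> x \<le> ?C})"
      using AEt E by (intro emeasure_eq_AE) auto
    also have "\<dots> = (\<integral>\<^sup>+x. ?\<rho> x * indicator (E \<inter> {x. ?\<rho> x \<le> ?C}) x \<partial>m)"
      by (subst dens[symmetric]) (rule emeasure_density[OF _ Em], simp)
    also have "\<dots> \<le> (\<integral>\<^sup>+x. ?C * indicator E x \<partial>m)"
      by (intro nn_integral_mono) (auto simp: indicator_def)
    also have "\<dots> = ?C * emeasure m E"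
      using E sets_eq_borel by (simp add: nn_integral_cmult_indicator)
    finally show ?thesis .
  qed
  show thesis by (rule that[OF \<pi> main])
qed

section \<open>Passing to the limit in \<open>L\<^sup>2\<close>\<close>

lemma L2D:
  assumes "h \<in> L2 M"
  shows "h \<in> borel_measurable M" "integrable M (\<lambda>x. (h x)\<^sup>2)"
  using assms by (auto simp: L2_def)

lemma L2_integrable_mult:
  assumes "h \<in> L2 M" "v \<in> L2 M"
  shows "integrable M (\<lambda>x. h x * v x)"
proof (rule Bochner_Integration.integrable_bound)
  show "integrable M (\<lambda>x. (h x)\<^sup>2 + (v x)\<^sup>2)" using assms by (simp add: L2_def)
  have "\<bar>a * b\<bar> \<le> a\<^sup>2 + b\<^sup>2" for a b :: real
    using sum_squares_bound[of "\<bar>a\<bar>" "\<bar>b\<bar>"] mult_nonneg_nonneg[of "\<bar>a\<bar>" "\<bar>b\<bar>"]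
    unfolding abs_mult power2_abs by linarith
  then show "AE x in M. norm (h x * v x) \<le> norm ((h x)\<^sup>2 + (v x)\<^sup>2)" by simp
qed (use assms in \<open>auto simp: L2_def\<close>)

lemma L2_diff:
  assumes "h \<in> L2 M" "v \<in> L2 M"
  shows "(\<lambda>x. h x - v x) \<in> L2 M"
proof -
  have "integrable M (\<lambda>x. (h x)\<^sup>2 + (v x)\<^sup>2 - 2 * (h x * v x))"
    using assms L2_integrable_mult[OF assms] by (simp add: L2_def)
  then show ?thesis
    using assms by (auto simp: L2_def power2_diff mult.assoc)
qed

text \<open>Young's inequality with weight \<open>\<parallel>F\<^sub>n - f\<parallel> + 1/(n+1)\<close>, which is positive, replaces the
  Cauchy--Schwarz inequality.\<close>

lemma L2_tendsto_integral_mult: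
  assumes F: "L2_tendsto M F f" and v: "v \<in> L2 M"
  shows "(\<lambda>n. \<integral>x. F n x * v x \<partial>M) \<longlonglongrightarrow> (\<integral>x. f x * v x \<partial>M)"
proof -
  have Fn: "F n \<in> L2 M" and f: "f \<in> L2 M"
    and lim: "(\<lambda>n. L2_norm M (\<lambda>x. F n x - f x)) \<longlonglongrightarrow> 0" for n
    using F by (auto simp: L2_tendsto_def)
  define s where "s n = L2_norm M (\<lambda>x. F n x - f x) + 1 / real (Suc n)" for n
  define V where "V = (\<integral>x. (v x)\<^sup>2 \<partial>M)"
  have s_pos: "0 < s n" for n
    unfolding s_def L2_norm_def by (intro add_nonneg_pos) auto
  have bound: "\<bar>(\<integral>x. F n x * v x \<partial>M) - (\<integral>x. f x * v x \<partial>M)\<bar> \<le> s n / 2 + s n * V / 2" for n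
  proof -
    let ?u = "\<lambda>x. F n x - f x"
    have u: "?u \<in> L2 M" by (rule L2_diff[OF Fn f])
    have young: "\<bar>a * b\<bar> \<le> a\<^sup>2 / (2 * s n) + s n * b\<^sup>2 / 2" for a b
    proof -
      have "0 \<le> (\<bar>a\<bar> - s n * \<bar>b\<bar>)\<^sup>2 / (2 * s n)" using s_pos[of n] by simp
      also have "\<dots> = a\<^sup>2 / (2 * s n) + s n * b\<^sup>2 / 2 - \<bar>a * b\<bar>"
        using s_pos[of n] by (simp add: power2_diff abs_mult power_mult_distrib field_simps power2_eq_square)
      finally show ?thesis by simp
    qed
    have "\<bar>(\<integral>x. F n x * v x \<partial>M) - (\<integral>x. f x * v x \<partial>M)\<bar> = \<bar>\<integral>x. ?u x * v x \<partial>M\<bar>"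
      using L2_integrable_mult[OF Fn v, of n] L2_integrable_mult[OF f v] by (simp add: left_diff_distrib)
    also have "\<dots> \<le> (\<integral>x. \<bar>?u x * v x\<bar> \<partial>M)" by (rule integral_abs_bound)
    also have "\<dots> \<le> (\<integral>x. (?u x)\<^sup>2 / (2 * s n) + s n * (v x)\<^sup>2 / 2 \<partial>M)"
      using L2_integrable_mult[OF u v] L2D(2)[OF u] L2D(2)[OF v] young
      by (intro integral_mono) auto
    also have "\<dots> = (\<integral>x. (?u x)\<^sup>2 \<partial>M) / (2 * s n) + s n * V / 2"
      using L2D(2)[OF u] L2D(2)[OF v] by (simp add: V_def)
    also have "(\<integral>x. (?u x)\<^sup>2 \<partial>M) = (L2_norm M ?u)\<^sup>2" by (simp add: L2_norm_def)
    also have "(L2_norm M ?u)\<^sup>2 / (2 * s n) \<le> (s n)\<^sup>2 / (2 * s n)"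
      using s_pos[of n]
      by (intro divide_right_mono power_mono) (auto simp: s_def L2_norm_def)
    also have "\<dots> = s n / 2" by (simp add: power2_eq_square)
    finally show ?thesis by simp
  qed
  have "(\<lambda>n. s n) \<longlonglongrightarrow> 0"
    unfolding s_def using tendsto_add[OF lim LIMSEQ_Suc[OF lim_1_over_n]] by simp
  then have "(\<lambda>n. s n / 2 + s n * V / 2) \<longlonglongrightarrow> 0"
    by (auto intro!: tendsto_eq_intros)
  then have "(\<lambda>n. (\<integral>x. F n x * v x \<partial>M) - (\<integral>x. f x * v x \<partial>M)) \<longlonglongrightarrow> 0"
    by (rule Lim_null_comparison[rotated]) (use bound in auto)
  then show ?thesis by (simp add: LIM_zero_iff)
qed

text \<open>On the set where \<open>h > C\<close> the integral of \<open>h\<close> is at least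
  \<open>C\<close> times the measure, and \<open>le\<close> gives the converse. The two integrals
  agree and are finite, so they may be subtracted, and the excess \<open>h - C\<close> vanishes
  there almost everywhere.\<close>

lemma AE_density_le:
  assumes [measurable]: "h \<in> borel_measurable M" and "finite_measure (density M h)"
    and le: "\<And>E. E \<in> sets M \<Longrightarrow> emeasure (density M h) E \<le> C * emeasure M E"
  shows "AE x in M. h x \<le> C"
proof -
  interpret finite_measure "density M h" by fact
  let ?E = "{x\<in>space M. C < h x}"
  have E: "?E \<in> sets M" by measurable
  have h: "(\<integral>\<^sup>+x. h x * indicator ?E x \<partial>M) = emeasure (density M h) ?E"
    using E by (simp add: emeasure_density)
  have c: "(\<integral>\<^sup>+x. C * indicator ?E x \<partial>M) = C * emeasure M ?E"
    using E by (simp add: nn_integral_cmult_indicator)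
  have mono: "(\<integral>\<^sup>+x. C * indicator ?E x \<partial>M) \<le> (\<integral>\<^sup>+x. h x * indicator ?E x \<partial>M)"
    by (intro nn_integral_mono) (auto simp: indicator_def)
  then have fin: "(\<integral>\<^sup>+x. C * indicator ?E x \<partial>M) \<noteq> \<infinity>"
    unfolding h using emeasure_finite[of ?E] by (auto simp: top_unique)
  have "(\<integral>\<^sup>+x. h x * indicator ?E x - C * indicator ?E x \<partial>M)
      = (\<integral>\<^sup>+x. h x * indicator ?E x \<partial>M) - (\<integral>\<^sup>+x. C * indicator ?E x \<partial>M)"
    using E fin by (intro nn_integral_diff) (auto simp: indicator_def)
  also have "\<dots> = 0"
    unfolding h c using le[OF E] by (intro diff_eq_0_ennreal) (simp_all add: less_top[symmetric])
  finally have "AE x in M. h x * indicator ?E x - C * indicator ?E x = 0"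
    using E by (subst (asm) nn_integral_0_iff_AE) auto
  with AE_space show ?thesis
  proof eventually_elim
    case (elim x)
    then show ?case
      by (cases "C < h x") (auto simp: indicator_def not_less dest: ennreal_minus_eq_0)
  qed
qed

lemma density_L2_integral:
  assumes h: "h \<in> L2 M" and v: "v \<in> L2 M" "\<And>x. 0 \<le> v x"
  shows "integrable (density M (\<lambda>x. ennreal (v x))) h"
    "(\<integral>x. h x \<partial>density M (\<lambda>x. ennreal (v x))) = (\<integral>x. h x * v x \<partial>M)"
proof -
  note m = L2D(1)[OF h] L2D(1)[OF v(1)]
  show "integrable (density M (\<lambda>x. ennreal (v x))) h"
    using L2_integrable_mult[OF h v(1)] m v(2)
    by (subst integrable_density) (auto simp: mult.commute)
  show "(\<integral>x. h x \<partial>density M (\<lambda>x. ennreal (v x))) = (\<integral>x. h x * v x \<partial>M)"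
    using m v(2) by (subst integral_density) (auto simp: mult.commute)
qed

text \<open>A density that is integrable and bounded by \<open>C\<close> is square integrable, as
  its square is at most \<open>C\<close> times itself. This makes it an admissible test function for
  weak convergence.\<close>

lemma bounded_density_L2:
  assumes "prob_space \<nu>" and dens: "density M h = \<nu>" and [measurable]: "h \<in> borel_measurable M"
    and le: "\<And>E. E \<in> sets M \<Longrightarrow> emeasure \<nu> E \<le> ennreal C * emeasure M E"
  obtains w where "w \<in> L2 M" "\<And>x. 0 \<le> w x" "density M (\<lambda>x. ennreal (w x)) = \<nu>"
    "integrable M w" "(\<integral>x. w x \<partial>M) = 1"
proof
  interpret prob_space \<nu> by fact
  let ?w = "\<lambda>x. enn2real (h x)"
  have AE_le: "AE x in M. h x \<le> ennreal C"
    using le finite_measure_axioms unfolding dens[symmetric] by (intro AE_density_le) auto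
  then have AE_eq: "AE x in M. ennreal (?w x) = h x"
    by eventually_elim (auto simp: ennreal_enn2real_if top_unique)
  show d: "density M (\<lambda>x. ennreal (?w x)) = \<nu>"
    unfolding dens[symmetric] using AE_eq by (intro density_cong) auto
  show nn: "0 \<le> ?w x" for x by simp
  have "(\<integral>\<^sup>+x. ennreal (?w x) \<partial>M) = emeasure (density M (\<lambda>x. ennreal (?w x))) (space M)"
    by (simp add: emeasure_density cong: nn_integral_cong)
  also have "\<dots> = 1"
    unfolding d using emeasure_space_1 by (simp add: dens[symmetric])
  finally have one: "(\<integral>\<^sup>+x. ennreal (?w x) \<partial>M) = 1" .
  then show int: "integrable M ?w"
    by (intro integrableI_nonneg) auto
  show "(\<integral>x. ?w x \<partial>M) = 1"
    using one by (simp add: integral_eq_nn_integral)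
  have "integrable M (\<lambda>x. (?w x)\<^sup>2)"
  proof (rule Bochner_Integration.integrable_bound)
    \<comment> \<open>The sign of \<open>C\<close> is not fixed, but \<open>ennreal C\<close> is at
      most \<open>ennreal \<bar>C\<bar>\<close> in any case.\<close>
    show "integrable M (\<lambda>x. \<bar>C\<bar> * ?w x)" using int by simp
    show "AE x in M. norm ((?w x)\<^sup>2) \<le> norm (\<bar>C\<bar> * ?w x)"
      using AE_le
    proof eventually_elim
      case (elim x)
      then have "?w x \<le> \<bar>C\<bar>"
        by (intro enn2real_leI) (auto intro: order_trans ennreal_leI)
      then show ?case by (simp add: power2_eq_square mult_right_mono)
    qed
  qed measurable
  then show "?w \<in> L2 M" by (simp add: L2_def)
qed

lemma (in metric_measure_space) uniform_measure_density_L2: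
  assumes S: "compact S" "emeasure m S > 0"
  obtains v where "v \<in> L2 m" "\<And>x. 0 \<le> v x"
    "density m (\<lambda>x. ennreal (v x)) = uniform_measure m S"
proof
  have Sm: "S \<in> sets m" using S by (auto simp: sets_eq_borel compact_imp_closed)
  have fin: "emeasure m S < \<infinity>" by (rule uniform_measure_compact(3)[OF S])
  have eS: "emeasure m S = ennreal (measure m S)"
    using fin by (intro emeasure_eq_ennreal_measure) auto
  have pos: "0 < measure m S" using S(2) unfolding eS by simp
  let ?v = "\<lambda>x. indicator S x / measure m S :: real"
  show "density m (\<lambda>x. ennreal (?v x)) = uniform_measure m S"
    unfolding uniform_measure_def using Sm pos divide_ennreal[of 1 "measure m S"]
    by (intro density_cong) (auto simp: eS indicator_def)
  show "0 \<le> ?v x" for x by simp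
  have "(\<lambda>x. (?v x)\<^sup>2) = (\<lambda>x. indicator S x / (measure m S)\<^sup>2)"
    by (auto simp: indicator_def power_divide)
  then show "?v \<in> L2 m" using Sm fin by (simp add: L2_def)
qed

text \<open>Every term becomes a pairing with a fixed function in \<open>L2 m\<close>: the averages
  with \<open>vA\<close> and \<open>vB\<close>, the slopes along the geodesics with the density
  \<open>w\<close> of \<open>\<nu>\<close>. Strong convergence of \<open>F n\<close> then handles
  the left side and weak convergence of the slopes the right side.\<close>

lemma (in metric_measure_space) QCD_average_difference_le:
  assumes mon: "monge_space m" and QCD: "QCD m Q K N" and QN: "Q \<ge> 1" "N > 1"
    and F: "\<And>n. F n \<in> Lip_bs" "L2_tendsto m F f"
    and g: "L2_weakly_tendsto m (\<lambda>n x. enn2real (metric_slope (F n) x)) g" "AE x in m. g x \<le> 1"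
    and A: "compact A" "emeasure m A > 0" and B: "compact B" "emeasure m B > 0"
    and D: "\<And>x y. x \<in> A \<Longrightarrow> y \<in> B \<Longrightarrow> dist x y \<le> D"
  shows "(\<integral>x. f x \<partial>uniform_measure m B) - (\<integral>x. f x \<partial>uniform_measure m A) \<le> D"
proof -
  interpret sigma_finite_measure m by (rule sigma_finite_measure_m)
  obtain \<pi> C where \<pi>: "\<pi> \<in> OptGeo (uniform_measure m A) (uniform_measure m B)"
    and compr: "\<And>t E. t \<in> {0<..<1} \<Longrightarrow> E \<in> sets borel \<Longrightarrow>
       emeasure (distr \<pi> borel (\<lambda>\<gamma>. \<gamma> t)) E \<le> ennreal C * emeasure m E"
    using QCD_bounded_compression[OF mon QCD QN A B] by metis
  have sets_\<pi>: "sets \<pi> = sets borel_curves" and d0: "distr \<pi> borel (\<lambda>\<gamma>. \<gamma> 0) = uniform_measure m A"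
    and d1: "distr \<pi> borel (\<lambda>\<gamma>. \<gamma> 1) = uniform_measure m B"
    and geo: "AE \<gamma> in \<pi>. \<gamma> \<in> Geo" and prob_\<pi>: "prob_space \<pi>"
    using \<pi> by (auto simp: OptGeo_def)
  have ev: "(\<lambda>\<gamma>. \<gamma> t) \<in> \<pi> \<rightarrow>\<^sub>M borel" if "t \<in> {0..1}" for t
    using measurable_evaluation[OF that] by (subst measurable_cong_sets[OF sets_\<pi> refl])
  interpret \<pi>: prob_space \<pi> by fact
  interpret U: prob_space unit_lborel by (rule prob_space_unit_lborel)
  interpret P: pair_prob_space \<pi> unit_lborel ..
  let ?P = "\<pi> \<Otimes>\<^sub>M unit_lborel"
  let ?e = "\<lambda>z. fst z (snd z)"
  have e[measurable]: "?e \<in> ?P \<rightarrow>\<^sub>M borel"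
    using measurable_joint_evaluation
    by (subst measurable_cong_sets[OF sets_pair_measure_cong[OF sets_\<pi> refl] refl])
  define \<nu> where "\<nu> = distr ?P borel ?e"
  have prob_\<nu>: "prob_space \<nu>" unfolding \<nu>_def by (rule P.prob_space_distr[OF e])
  have \<nu>_le: "emeasure \<nu> E \<le> ennreal C * emeasure m E" if "E \<in> sets m" for E
  proof -
    have E[measurable]: "E \<in> sets borel" using that sets_eq_borel by simp
    have "emeasure \<nu> E = (\<integral>\<^sup>+x. indicator E x \<partial>\<nu>)" by (simp add: \<nu>_def)
    also have "\<dots> = (\<integral>\<^sup>+z. indicator E (?e z) \<partial>?P)"
      unfolding \<nu>_def by (rule nn_integral_distr[OF e]) simp
    also have "\<dots> = (\<integral>\<^sup>+t. (\<integral>\<^sup>+\<gamma>. indicator E (\<gamma> t) \<partial>\<pi>) \<partial>unit_lborel)"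
      by (subst P.nn_integral_snd[symmetric]) auto
    also have "\<dots> \<le> (\<integral>\<^sup>+t. ennreal C * emeasure m E \<partial>unit_lborel)"
    proof (rule nn_integral_mono_AE)
      \<comment> \<open>The compression bound is available at interior times only; the two end times
        are negligible.\<close>
      have "AE t in unit_lborel. t \<in> {0<..<1}"
        using AE_lborel_singleton[of 0] AE_lborel_singleton[of 1]
        by (subst AE_restrict_space_iff) (auto elim: eventually_elim2)
      then show "AE t in unit_lborel. (\<integral>\<^sup>+\<gamma>. indicator E (\<gamma> t) \<partial>\<pi>) \<le> ennreal C * emeasure m E"
      proof eventually_elim
        case (elim t)
        then have "(\<lambda>\<gamma>. \<gamma> t) \<in> \<pi> \<rightarrow>\<^sub>M borel" by (intro ev) auto
        then have "(\<integral>\<^sup>+\<gamma>. indicator E (\<gamma> t) \<partial>\<pi>) = (\<integral>\<^sup>+x. indicator E x \<partial>distr \<pi> borel (\<lambda>\<gamma>. \<gamma> t))"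
          by (intro nn_integral_distr[symmetric]) simp_all
        then show ?case using compr[OF elim E] by simp
      qed
    qed
    also have "\<dots> = ennreal C * emeasure m E"
      using U.emeasure_space_1 by simp
    finally show ?thesis .
  qed
  have "absolutely_continuous m \<nu>"
    unfolding absolutely_continuous_def
  proof
    fix E assume "E \<in> null_sets m"
    then have "E \<in> sets m" "emeasure m E = 0" by auto
    then show "E \<in> null_sets \<nu>" using \<nu>_le[of E] sets_eq_borel by (auto simp: null_sets_def \<nu>_def)
  qed
  then have "density m (RN_deriv m \<nu>) = \<nu>"
    using sets_eq_borel by (intro density_RN_deriv) (auto simp: \<nu>_def)
  then obtain w where w: "w \<in> L2 m" "\<And>x. 0 \<le> w x" "density m (\<lambda>x. ennreal (w x)) = \<nu>"
    "integrable m w" "(\<integral>x. w x \<partial>m) = 1"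
    using bounded_density_L2[OF prob_\<nu> _ borel_measurable_RN_deriv \<nu>_le] by blast
  obtain vA where vA: "vA \<in> L2 m" "\<And>x. 0 \<le> vA x" "density m (\<lambda>x. ennreal (vA x)) = uniform_measure m A"
    using uniform_measure_density_L2[OF A] by blast
  obtain vB where vB: "vB \<in> L2 m" "\<And>x. 0 \<le> vB x" "density m (\<lambda>x. ennreal (vB x)) = uniform_measure m B"
    using uniform_measure_density_L2[OF B] by blast
  have f: "f \<in> L2 m" and Fn: "F n \<in> L2 m" for n using F(2) by (auto simp: L2_tendsto_def)
  let ?s = "\<lambda>n x. enn2real (metric_slope (F n) x)"
  have s: "?s n \<in> L2 m" and gL2: "g \<in> L2 m" for n using g(1) by (auto simp: L2_weakly_tendsto_def)
  note avA = density_L2_integral[OF _ vA(1,2), unfolded vA(3)]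
  note avB = density_L2_integral[OF _ vB(1,2), unfolded vB(3)]
  note avw = density_L2_integral[OF _ w(1,2), unfolded w(3)]
  have AE_D: "AE \<gamma> in \<pi>. dist (\<gamma> 0) (\<gamma> 1) \<le> D"
  proof -
    have Am: "A \<in> sets m" "B \<in> sets m" using A B by (auto simp: sets_eq_borel compact_imp_closed)
    have "AE x in distr \<pi> borel (\<lambda>\<gamma>. \<gamma> 0). x \<in> A"
      unfolding d0 using Am by (intro AE_uniform_measureI) auto
    then have g0: "AE \<gamma> in \<pi>. \<gamma> 0 \<in> A" by (rule AE_distrD[OF ev, rotated]) simp
    have "AE x in distr \<pi> borel (\<lambda>\<gamma>. \<gamma> 1). x \<in> B"
      unfolding d1 using Am by (intro AE_uniform_measureI) auto
    then have "AE \<gamma> in \<pi>. \<gamma> 1 \<in> B" by (rule AE_distrD[OF ev, rotated]) simp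
    with g0 show ?thesis by eventually_elim (rule D)
  qed
  have step: "(\<integral>x. F n x * vB x \<partial>m) - (\<integral>x. F n x * vA x \<partial>m) \<le> D * (\<integral>x. ?s n x * w x \<partial>m)" for n
  proof -
    obtain L where L: "L-lipschitz_on UNIV (F n)" using F(1)[of n] by (auto simp: Lip_bs_def)
    have Fm[measurable]: "F n \<in> borel_measurable borel"
      by (rule borel_measurable_continuous_onI[OF lipschitz_on_continuous_on[OF L]])
    \<comment> \<open>Measurability of the slope is contained in the weak convergence, which places
      it in \<open>L2 m\<close>.\<close>
    have sm[measurable]: "?s n \<in> borel_measurable borel"
      using L2D(1)[OF s[of n]] by (subst (asm) measurable_cong_sets[OF sets_eq_borel refl])
    have iA: "integrable \<pi> (\<lambda>\<gamma>. F n (\<gamma> 0))" "(\<integral>\<gamma>. F n (\<gamma> 0) \<partial>\<pi>) = (\<integral>x. F n x * vA x \<partial>m)"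
      using avA[OF Fn[of n]] ev[of 0] unfolding d0[symmetric]
      by (auto simp: integrable_distr_eq integral_distr)
    have iB: "integrable \<pi> (\<lambda>\<gamma>. F n (\<gamma> 1))" "(\<integral>\<gamma>. F n (\<gamma> 1) \<partial>\<pi>) = (\<integral>x. F n x * vB x \<partial>m)"
      using avB[OF Fn[of n]] ev[of 1] unfolding d1[symmetric]
      by (auto simp: integrable_distr_eq integral_distr)
    have iP: "integrable ?P (\<lambda>z. ?s n (?e z))"
      using avw(1)[OF s[of n]] unfolding \<nu>_def by (subst (asm) integrable_distr_eq) auto
    have eP: "(\<integral>z. ?s n (?e z) \<partial>?P) = (\<integral>x. ?s n x * w x \<partial>m)"
      using avw(2)[OF s[of n]] unfolding \<nu>_def by (subst (asm) integral_distr) auto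
    have fub: "integrable \<pi> (\<lambda>\<gamma>. \<integral>t. ?s n (\<gamma> t) \<partial>unit_lborel)"
      "(\<integral>\<gamma>. (\<integral>t. ?s n (\<gamma> t) \<partial>unit_lborel) \<partial>\<pi>) = (\<integral>z. ?s n (?e z) \<partial>?P)"
      using P.integrable_fst'[OF iP] P.integral_fst'[OF iP] by simp_all
    have "(\<integral>\<gamma>. F n (\<gamma> 1) - F n (\<gamma> 0) \<partial>\<pi>) \<le> (\<integral>\<gamma>. D * (\<integral>t. ?s n (\<gamma> t) \<partial>unit_lborel) \<partial>\<pi>)"
    proof (rule integral_mono_AE)
      show "AE \<gamma> in \<pi>. F n (\<gamma> 1) - F n (\<gamma> 0) \<le> D * (\<integral>t. ?s n (\<gamma> t) \<partial>unit_lborel)"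
        using geo AE_D by eventually_elim (rule geodesic_upper_gradient[OF _ L sm])
    qed (use iA iB fub in auto)
    then show ?thesis using iA iB fub eP by simp
  qed
  have "(\<lambda>n. (\<integral>x. F n x * vB x \<partial>m) - (\<integral>x. F n x * vA x \<partial>m))
      \<longlonglongrightarrow> (\<integral>x. f x * vB x \<partial>m) - (\<integral>x. f x * vA x \<partial>m)"
    by (intro tendsto_diff L2_tendsto_integral_mult F(2) vA(1) vB(1))
  moreover have "(\<lambda>n. D * (\<integral>x. ?s n x * w x \<partial>m)) \<longlonglongrightarrow> D * (\<integral>x. g x * w x \<partial>m)"
    using g(1) w(1) by (intro tendsto_mult_left) (auto simp: L2_weakly_tendsto_def)
  ultimately have "(\<integral>x. f x * vB x \<partial>m) - (\<integral>x. f x * vA x \<partial>m) \<le> D * (\<integral>x. g x * w x \<partial>m)"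
    by (rule LIMSEQ_le) (use step in blast)
  also have "\<dots> \<le> D * 1"
  proof (rule mult_left_mono)
    have "(\<integral>x. g x * w x \<partial>m) \<le> (\<integral>x. w x \<partial>m)"
    proof (rule integral_mono_AE)
      show "AE x in m. g x * w x \<le> w x"
        using g(2) by eventually_elim (use w(2) mult_right_mono in fastforce)
    qed (use L2_integrable_mult[OF gL2 w(1)] w(4) in auto)
    then show "(\<integral>x. g x * w x \<partial>m) \<le> 1" using w(5) by simp
    \<comment> \<open>Positive measure provides a point in each set, and their distance is a
      nonnegative number below \<open>D\<close>.\<close>
    have "A \<noteq> {}" "B \<noteq> {}" using A(2) B(2) by auto
    then show "0 \<le> D" using D by (metis equals0I order_trans zero_le_dist)
  qed
  finally show ?thesis using avA(2)[OF f] avB(2)[OF f] by simp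
qed

section \<open>The Lipschitz representative\<close>

text \<open>Inner regularity of finite Borel measures on a Polish space, applied to the restriction
  of \<open>m\<close> to \<open>S\<close>, which is finite because \<open>S\<close> is
  bounded.\<close>

lemma (in metric_measure_space) compact_subset_positive:
  assumes "S \<in> sets borel" "bounded S" "emeasure m S > 0"
  obtains T where "compact T" "T \<subseteq> S" "emeasure m T > 0"
proof -
  let ?n = "density m (indicator S)"
  have S: "S \<in> sets m" using assms(1) sets_eq_borel by simp
  have n: "emeasure ?n T = emeasure m (S \<inter> T)" if "T \<in> sets borel" for T
    using that S sets_eq_borel
    by (simp add: emeasure_density indicator_inter_arith[symmetric])
  have "emeasure ?n (space ?n) = emeasure m S"
    using n[of UNIV] sets_eq_imp_space_eq[OF sets_eq_borel] by simp
  then have "emeasure ?n (space ?n) \<noteq> \<infinity>" using finite_on_bounded[OF assms(1,2)] by auto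
  then have "emeasure ?n S = (SUP T \<in> {T. T \<subseteq> S \<and> compact T}. emeasure ?n T)"
    using assms(1) sets_eq_borel by (intro inner_regular) auto
  moreover have "0 < emeasure ?n S" using n[OF assms(1)] assms(3) by simp
  ultimately obtain T where T: "T \<subseteq> S" "compact T" "0 < emeasure ?n T"
    by (auto simp: less_SUP_iff)
  then show thesis using that[of T] n[of T] by (simp add: compact_imp_closed inf.absorb2)
qed

text \<open>On compact subsets of the two level sets the averages of \<open>f\<close> are at most
  \<open>a\<close> and at least \<open>b\<close>, while points of the two balls are at most
  \<open>dist p q + 2 * r\<close> apart.\<close>

lemma (in metric_measure_space) QCD_level_gap_le:
  assumes mon: "monge_space m" and QCD: "QCD m Q K N" and QN: "Q \<ge> 1" "N > 1"
    and g: "g \<in> relaxed_gradients m f" "AE x in m. g x \<le> 1"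
    and p: "emeasure m {x \<in> ball p r. f x \<le> a} > 0"
    and q: "emeasure m {x \<in> ball q r. b \<le> f x} > 0"
  shows "b - a \<le> dist p q + 2 * r"
proof -
  obtain F where F: "\<And>n. F n \<in> Lip_bs" "L2_tendsto m F f"
    "L2_weakly_tendsto m (\<lambda>n x. enn2real (metric_slope (F n) x)) g"
    using g(1) by (auto simp: relaxed_gradients_def)
  have fL2: "f \<in> L2 m" using F(2) by (simp add: L2_tendsto_def)
  have fm[measurable]: "f \<in> borel_measurable borel"
    using L2D(1)[OF fL2] by (subst (asm) measurable_cong_sets[OF sets_eq_borel refl])
  have sets: "{x \<in> ball p r. f x \<le> a} \<in> sets borel" "{x \<in> ball q r. b \<le> f x} \<in> sets borel"
    by measurable
  have bdd: "bounded {x \<in> ball p r. f x \<le> a}" "bounded {x \<in> ball q r. b \<le> f x}"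
    by (auto intro: bounded_subset[OF bounded_ball])
  obtain A where A: "compact A" "A \<subseteq> {x \<in> ball p r. f x \<le> a}" "emeasure m A > 0"
    by (rule compact_subset_positive[OF sets(1) bdd(1) p])
  obtain B where B: "compact B" "B \<subseteq> {x \<in> ball q r. b \<le> f x}" "emeasure m B > 0"
    by (rule compact_subset_positive[OF sets(2) bdd(2) q])
  have D: "dist x y \<le> dist p q + 2 * r" if "x \<in> A" "y \<in> B" for x y
  proof -
    have "dist p x < r" "dist q y < r" using that A(2) B(2) by auto
    then show ?thesis
      using dist_triangle[of x y p] dist_triangle[of p y q] by (simp add: dist_commute)
  qed
  have int: "integrable (uniform_measure m S) f" "prob_space (uniform_measure m S)"
    "AE x in uniform_measure m S. x \<in> S" if S: "compact S" "emeasure m S > 0" for S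
  proof -
    have Sm: "S \<in> sets m" using S by (auto simp: sets_eq_borel compact_imp_closed)
    show "AE x in uniform_measure m S. x \<in> S" using Sm by (intro AE_uniform_measureI) auto
    show pr: "prob_space (uniform_measure m S)"
      using uniform_measure_compact(1)[OF S] by (simp add: Pcm_def borel_prob_def)
    obtain v where v: "v \<in> L2 m" "\<And>x. 0 \<le> v x" "density m (\<lambda>x. ennreal (v x)) = uniform_measure m S"
      using uniform_measure_density_L2[OF S] by blast
    show "integrable (uniform_measure m S) f"
      using density_L2_integral(1)[OF fL2 v(1,2)] unfolding v(3) .
  qed
  have "(\<integral>x. f x \<partial>uniform_measure m A) \<le> a"
    using int(3)[OF A(1,3)] A(2)
    by (intro prob_space.integral_le_const int A) (auto elim!: eventually_mono)
  moreover have "b \<le> (\<integral>x. f x \<partial>uniform_measure m B)"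
    using int(3)[OF B(1,3)] B(2)
    by (intro prob_space.integral_ge_const int B) (auto elim!: eventually_mono)
  moreover have "(\<integral>x. f x \<partial>uniform_measure m B) - (\<integral>x. f x \<partial>uniform_measure m A) \<le> dist p q + 2 * r"
    by (rule QCD_average_difference_le[OF mon QCD QN F g(2) A(1,3) B(1,3) D])
  ultimately show ?thesis by linarith
qed

text \<open>McShane's extension: the infimum of the cones of slope \<open>L\<close> with apex on the
  graph of \<open>f\<close>.\<close>

lemma lipschitz_extension_real:
  fixes f :: "'a::metric_space \<Rightarrow> real"
  assumes lip: "L-lipschitz_on G f" and "G \<noteq> {}"
  obtains f' where "L-lipschitz_on UNIV f'" "\<And>x. x \<in> G \<Longrightarrow> f' x = f x"
proof
  have L: "0 \<le> L" using lip by (rule lipschitz_on_nonneg)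
  let ?f = "\<lambda>x. INF y\<in>G. f y + L * dist x y"
  \<comment> \<open>A real infimum needs a lower bound: by the Lipschitz condition on
    \<open>G\<close>, the downward cone at any \<open>z\<close> in \<open>G\<close> provides
    one.\<close>
  have bdd: "bdd_below ((\<lambda>y. f y + L * dist x y) ` G)" for x
  proof -
    obtain z where z: "z \<in> G" using assms(2) by blast
    have "f z - L * dist z x \<le> f y + L * dist x y" if "y \<in> G" for y
    proof -
      have "f z - f y \<le> L * dist z y"
        using lipschitz_onD[OF lip z that] by (simp add: dist_real_def)
      also have "\<dots> \<le> L * (dist z x + dist x y)" by (intro mult_left_mono dist_triangle L)
      finally show ?thesis by (simp add: algebra_simps)
    qed
    then show ?thesis by (rule bdd_belowI2)
  qed
  have le: "?f x \<le> ?f x' + L * dist x x'" for x x'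
  proof -
    have "?f x - L * dist x x' \<le> ?f x'"
    proof (rule cINF_greatest[OF assms(2)])
      fix y assume y: "y \<in> G"
      have "?f x \<le> f y + L * dist x y" by (rule cINF_lower[OF bdd y])
      also have "\<dots> \<le> f y + L * (dist x x' + dist x' y)"
        by (intro add_left_mono mult_left_mono dist_triangle L)
      finally show "?f x - L * dist x x' \<le> f y + L * dist x' y" by (simp add: algebra_simps)
    qed
    then show ?thesis by simp
  qed
  show "L-lipschitz_on UNIV ?f"
  proof (rule lipschitz_onI[OF _ L])
    fix x y
    show "dist (?f x) (?f y) \<le> L * dist x y"
      using le[of x y] le[of y x] unfolding dist_real_def dist_commute[of y x] by linarith
  qed
  fix x assume x: "x \<in> G"
  show "?f x = f x"
  proof (rule antisym)
    show "?f x \<le> f x" using cINF_lower[OF bdd[of x] x] by simp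
    show "f x \<le> ?f x"
    proof (rule cINF_greatest[OF assms(2)])
      fix y assume "y \<in> G"
      then show "f x \<le> f y + L * dist x y"
        using lipschitz_onD[OF lip x] by (force simp: dist_real_def)
    qed
  qed
qed

theorem corollary3p7:
  fixes m :: "'a::polish_space measure"
    and Q K N :: real
    and f g :: "'a \<Rightarrow> real"
  assumes "metric_measure_space m"
    and "geodesic_space TYPE('a)"
    and "monge_space m"
    and "Q \<ge> 1" and "N > 1"
    and "QCD m Q K N"
    and "f \<in> W12 m \<inter> Linfty m"
    and "is_weak_min_upper_gradient m f g"
    and "AE x in m. g x \<le> 1"
  shows "\<exists>f'. 1-lipschitz_on UNIV f' \<and> (AE x in m. f x = f' x)"
proof -
  interpret metric_measure_space m by fact
  have g: "g \<in> relaxed_gradients m f"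
    using assms(8) by (simp add: is_weak_min_upper_gradient_def)
  note gap = QCD_level_gap_le[OF assms(3,6,4,5) g assms(9)]
  have fm[measurable]: "f \<in> borel_measurable borel"
    using assms(7) sets_eq_borel by (auto simp: Linfty_def cong: measurable_cong_sets)
  obtain S :: "'a set" where S: "countable S" "\<And>X. open X \<Longrightarrow> X \<noteq> {} \<Longrightarrow> \<exists>p\<in>S. p \<in> X"
    using countable_dense_setE by blast
  \<comment> \<open>Inside the braces \<open>x\<close> is bound anew; only the \<open>x\<close>
    before each membership sign is the point under test.\<close>
  define G where "G = {x. \<forall>p\<in>S. \<forall>r\<in>\<rat>. \<forall>a\<in>\<rat>.
      (x \<in> {x \<in> ball p r. f x \<le> a} \<longrightarrow> emeasure m {x \<in> ball p r. f x \<le> a} > 0) \<and>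
      (x \<in> {x \<in> ball p r. a \<le> f x} \<longrightarrow> emeasure m {x \<in> ball p r. a \<le> f x} > 0)}"
  have AE_pos: "AE x in m. x \<in> T \<longrightarrow> emeasure m T > 0" if "T \<in> sets borel" for T
  proof (cases "emeasure m T > 0")
    case False
    then have "T \<in> null_sets m" using that sets_eq_borel by auto
    then show ?thesis by (rule eventually_mono[OF AE_not_in]) auto
  qed auto
  \<comment> \<open>The instance of \<open>mem_Collect_eq\<close> matches only the outer
    comprehension, so the level sets stay in the form that \<open>AE_pos\<close> expects.\<close>
  have AE_G: "AE x in m. x \<in> G"
    unfolding G_def mem_Collect_eq[where P = "\<lambda>x. Ball S (H x)" for H]
    by (subst AE_ball_countable[OF S(1)], rule ballI,
        subst AE_ball_countable[OF countable_rat], rule ballI,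
        subst AE_ball_countable[OF countable_rat], rule ballI)
       (intro AE_conjI AE_pos; measurable)
  have lip: "f y - f x \<le> dist x y" if x: "x \<in> G" and y: "y \<in> G" for x y
  proof (rule field_le_epsilon)
    \<comment> \<open>The error is \<open>4 * r < e / 2\<close> from replacing \<open>x\<close> and
      \<open>y\<close> by centres and using balls, plus \<open>e / 4\<close> for each of the two
      levels.\<close>
    fix e :: real assume "0 < e"
    obtain r where r: "r \<in> \<rat>" "0 < r" "r < e / 8"
      using Rats_dense_in_real[of 0 "e / 8"] \<open>0 < e\<close> by auto
    obtain a where a: "a \<in> \<rat>" "f x < a" "a < f x + e / 4"
      using Rats_dense_in_real[of "f x" "f x + e / 4"] \<open>0 < e\<close> by auto
    obtain b where b: "b \<in> \<rat>" "f y - e / 4 < b" "b < f y"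
      using Rats_dense_in_real[of "f y - e / 4" "f y"] \<open>0 < e\<close> by auto
    obtain p where p: "p \<in> S" "dist x p < r" using S(2)[of "ball x r"] r by auto
    obtain q where q: "q \<in> S" "dist y q < r" using S(2)[of "ball y r"] r by auto
    have "emeasure m {x \<in> ball p r. f x \<le> a} > 0"
      using x p r a unfolding G_def by (auto simp: dist_commute)
    moreover have "emeasure m {x \<in> ball q r. b \<le> f x} > 0"
      using y q r b unfolding G_def by (auto simp: dist_commute)
    ultimately have "b - a \<le> dist p q + 2 * r" by (rule gap)
    moreover have "dist p q \<le> dist x y + 2 * r"
      using dist_triangle[of p q x] dist_triangle[of x q y] p(2) q(2) by (simp add: dist_commute)
    ultimately show "f y - f x \<le> dist x y + e" using a b r by linarith
  qed
  show ?thesis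
  proof (cases "G = {}")
    \<comment> \<open>Then the property \<open>False\<close> holds almost everywhere, so
      \<open>f\<close> agrees almost everywhere with the constant \<open>0\<close>.\<close>
    case True
    then have "AE x in m. f x = 0" using eventually_mono[OF AE_G] by blast
    then show ?thesis
      by (intro exI[of _ "\<lambda>_. 0"]) (simp add: lipschitz_on_def)
  next
    case False
    have "1-lipschitz_on G f"
    proof (rule lipschitz_onI)
      fix x y assume "x \<in> G" "y \<in> G"
      then show "dist (f x) (f y) \<le> 1 * dist x y"
        using lip[of x y] lip[of y x] by (simp add: dist_real_def abs_le_iff dist_commute)
    qed simp
    then obtain f' where "1-lipschitz_on UNIV f'" "\<And>x. x \<in> G \<Longrightarrow> f' x = f x"
      using lipschitz_extension_real[OF _ False] by blast
    with AE_G show ?thesis by (intro exI[of _ f'] conjI) (auto elim: eventually_mono)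
  qed
qed

end
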